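(* Suppose that on a probability space $(\Omega,\mathcal{F},\mathbb{P})$ there is a standard Brownian motion $B=(B_t)_{t\ge0}$ and a random variable $\varepsilon$ with $\mathbb{P}[\varepsilon=1]=\mathbb{P}[\varepsilon=-1]=1/2$, independent of $B$. Denote by $\mathbb{F}^B$ the filtration generated by $B$. For each $\mu>0$ there is an $\mathbb{F}^B$-predictable process $(\mu_t)_{t\ge0}$ taking values in the open interval $(0,2\mu)$ such that, defining $S=(S_t)_{t\ge0}$ by $S_0=0$ and $$dS_t=\mu_t\,dt+dB_t,\qquad t\ge0,$$ the process $Y_t=\varepsilon S_t$, $t\ge0$, is a Brownian motion in its own filtration.
   Context: For a process $X$, $\mathbb{F}^X=(\mathcal{F}^X_t)_{t\ge0}$ denotes the right-continuous, saturated (i.e. completed by $\mathbb{P}$-null sets) filtration generated by $X$. "Brownian motion in its own filtration" means that $X$ is an $\mathbb{F}^X$-Brownian motion (without drift). *)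

theory Defs
  imports "HOL-Probability.Probability"
begin

text \<open>
  Stochastic processes are functions \<open>X :: real \<Rightarrow> 'a \<Rightarrow> real\<close>, time first; only times \<open>t \<ge> 0\<close> are
  meaningful.
\<close>

definition natural_filtration :: "'a measure \<Rightarrow> (real \<Rightarrow> 'a \<Rightarrow> real) \<Rightarrow> real \<Rightarrow> 'a measure" where
  "natural_filtration M X t =
     sigma (space M) {X u -` A \<inter> space M | u A. 0 \<le> u \<and> u \<le> t \<and> A \<in> sets borel}"

text \<open>
  The saturated filtration contains all subsets of null sets, so its members are in general
  measurable only with respect to \<open>completion M\<close>.
\<close>

definition saturated_filtration :: "'a measure \<Rightarrow> (real \<Rightarrow> 'a \<Rightarrow> real) \<Rightarrow> real \<Rightarrow> 'a measure" where
  "saturated_filtration M X t =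
     sigma (space M) (sets (natural_filtration M X t) \<union> null_sets (completion M))"

definition generated_filtration :: "'a measure \<Rightarrow> (real \<Rightarrow> 'a \<Rightarrow> real) \<Rightarrow> real \<Rightarrow> 'a measure" where
  "generated_filtration M X t =
     sigma (space M) (\<Inter>s\<in>{t<..}. sets (saturated_filtration M X s))"

definition brownian_motion_wrt ::
    "'a measure \<Rightarrow> (real \<Rightarrow> 'a measure) \<Rightarrow> (real \<Rightarrow> 'a \<Rightarrow> real) \<Rightarrow> bool" where
  "brownian_motion_wrt M F X \<longleftrightarrow>
     prob_space M \<and>
     filtration (space M) F \<and>
     (\<forall>t\<ge>0. subalgebra M (F t)) \<and>
     (\<forall>t\<ge>0. X t \<in> borel_measurable (F t)) \<and>
     (AE \<omega> in M. X 0 \<omega> = 0) \<and>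
     (AE \<omega> in M. continuous_on {0..} (\<lambda>t. X t \<omega>)) \<and>
     (\<forall>s t. 0 \<le> s \<and> s < t \<longrightarrow>
        distributed M lborel (\<lambda>\<omega>. X t \<omega> - X s \<omega>) (normal_density 0 (sqrt (t - s))) \<and>
        prob_space.indep_set M (sets (F s))
          (sets (vimage_algebra (space M) (\<lambda>\<omega>. X t \<omega> - X s \<omega>) borel)))"

text \<open>
  Independence of the increments from the uncompleted natural filtration is the classical
  independent increments property; it makes no reference to null sets.
\<close>

definition standard_brownian_motion :: "'a measure \<Rightarrow> (real \<Rightarrow> 'a \<Rightarrow> real) \<Rightarrow> bool" where
  "standard_brownian_motion M X \<longleftrightarrow> brownian_motion_wrt M (natural_filtration M X) X"

text \<open>
  \<open>X\<close> is only required to be measurable with respect to \<open>completion M\<close>, on which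
  \<open>generated_filtration M X\<close> lives.
\<close>

definition brownian_motion_in_own_filtration :: "'a measure \<Rightarrow> (real \<Rightarrow> 'a \<Rightarrow> real) \<Rightarrow> bool" where
  "brownian_motion_in_own_filtration M X \<longleftrightarrow>
     brownian_motion_wrt (completion M) (generated_filtration M X) X"

definition predictable_algebra :: "'a set \<Rightarrow> (real \<Rightarrow> 'a measure) \<Rightarrow> (real \<times> 'a) measure" where
  "predictable_algebra \<Omega> F =
     sigma ({0..} \<times> \<Omega>)
       ({{0} \<times> A | A. A \<in> sets (F 0)} \<union>
        {{s<..t} \<times> A | s t A. 0 \<le> s \<and> s < t \<and> A \<in> sets (F s)})"

definition predictable :: "'a set \<Rightarrow> (real \<Rightarrow> 'a measure) \<Rightarrow> (real \<Rightarrow> 'a \<Rightarrow> real) \<Rightarrow> bool" where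
  "predictable \<Omega> F X \<longleftrightarrow> (\<lambda>(t, \<omega>). X t \<omega>) \<in> borel_measurable (predictable_algebra \<Omega> F)"

text \<open>
  The process with \<open>S 0 = 0\<close> and \<open>dS = m dt + dB\<close>. The increment \<open>B t - B 0\<close> is used because
  \<open>B 0 = 0\<close> is only required almost surely.
\<close>

definition drift_process ::
    "(real \<Rightarrow> 'a \<Rightarrow> real) \<Rightarrow> (real \<Rightarrow> 'a \<Rightarrow> real) \<Rightarrow> real \<Rightarrow> 'a \<Rightarrow> real" where
  "drift_process m B t \<omega> = (LBINT u:{0..t}. m u \<omega>) + (B t \<omega> - B 0 \<omega>)"

end

theory Submission
  imports Defs
begin

text \<open>
  Put \<open>X t = B t + \<mu> t\<close> and take the drift \<open>\<mu> (1 - tanh (\<mu> X t))\<close>. With \<open>U = \<epsilon> X = \<epsilon> B + \<epsilon> \<mu> t\<close> and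
  because \<open>tanh\<close> is odd, \<open>Y = \<epsilon> S\<close> becomes \<open>U - \<mu> \<integral> tanh (\<mu> U)\<close>. Here \<open>\<epsilon> B\<close> is a Brownian motion
  independent of the random drift direction \<open>\<epsilon>\<close>, and \<open>tanh (\<mu> U t)\<close> is the Wonham filter
  \<open>E(\<epsilon> | U s, s \<le> t)\<close>, so \<open>Y\<close> is the innovation process of the filtering problem, hence a
  Brownian motion in the filtration of \<open>U\<close> and a fortiori in its own.

  The filter identity follows from a Girsanov-type symmetry of the finite-dimensional laws of \<open>X\<close>
  and \<open>-X\<close> under the weight \<open>exp (-\<mu> X t)\<close>. Stochastic calculus is avoided: the conditional
  characteristic function of \<open>Y t - Y s\<close>, multiplied by \<open>exp (l\<^sup>2 t / 2)\<close>, changes by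
  \<open>O(h^{3/2})\<close> over time steps of length \<open>h\<close>, and is therefore constant.
\<close>

section \<open>Filtrations, independence and characteristic functions\<close>

text \<open>The weight \<open>exp (- \<mu> * x)\<close> is, up to a deterministic factor, the
  Girsanov density that turns the law of \<open>X\<close> into that of a driftless Brownian motion,
  and the latter is invariant under reflection. With equal prior weights for the two directions, the
  posterior odds given that \<open>U\<close> is at x are exp (2 \<mu> x), whose mean direction is
  tanh (\<mu> x). The exponent 3/2 has this origin. Over one step the innovation moves by a Gaussian
  part W of size h^(1/2) and a filtering error D of size h, and the two are dependent. Only D itself
  is known to have mean zero against the past, so the linear term iexp (l W) D is replaced by D, at
  a cost of order |W| |D|. As 3/2 exceeds 1, the errors of (t - s)/h steps still sum to something
  that vanishes. A further obstacle is the right-continuous, completed filtration: an event at time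
  s agrees, up to a null set, only with events observed up to each r > s. The characteristic
  function identity is therefore proved from r onwards, and r then decreases to s along the
  continuous paths.\<close>

lemma space_natural_filtration [simp]: "space (natural_filtration M X t) = space M"
  unfolding natural_filtration_def by (rule space_measure_of) auto

lemma space_saturated_filtration [simp]: "space (saturated_filtration M X t) = space M"
  unfolding saturated_filtration_def
  by (rule space_measure_of)
    (use sets.space_closed[of "natural_filtration M X t"] sets.space_closed[of "completion M"] in
      \<open>auto simp: null_sets_def\<close>)

lemma sets_natural_filtration:
  "sets (natural_filtration M X t) =
     sigma_sets (space M) {X u -` A \<inter> space M | u A. 0 \<le> u \<and> u \<le> t \<and> A \<in> sets borel}"
  unfolding natural_filtration_def by (rule sets_measure_of) auto

lemma sets_saturated_filtration:
  "sets (saturated_filtration M X t) =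
     sigma_sets (space M) (sets (natural_filtration M X t) \<union> null_sets (completion M))"
  unfolding saturated_filtration_def
  by (rule sets_measure_of)
    (use sets.space_closed[of "natural_filtration M X t"] sets.space_closed[of "completion M"] in
      \<open>auto simp: null_sets_def\<close>)

lemma measurable_natural_filtration:
  "0 \<le> u \<Longrightarrow> u \<le> t \<Longrightarrow> X u \<in> borel_measurable (natural_filtration M X t)"
  by (rule measurableI) (auto simp: sets_natural_filtration intro!: sigma_sets.Basic)

lemma sets_natural_filtration_subset:
  assumes "space F = space M" "\<And>u. 0 \<le> u \<Longrightarrow> u \<le> t \<Longrightarrow> X u \<in> borel_measurable F"
  shows "sets (natural_filtration M X t) \<subseteq> sets F"
  unfolding sets_natural_filtration assms(1)[symmetric]
  by (rule sets.sigma_sets_subset) (auto intro!: measurable_sets[OF assms(2)])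

lemma natural_filtration_mono:
  "s \<le> t \<Longrightarrow> sets (natural_filtration M X s) \<subseteq> sets (natural_filtration M X t)"
  by (rule sets_natural_filtration_subset) (auto intro: measurable_natural_filtration)

lemma subalgebra_natural_filtration_mono:
  "s \<le> t \<Longrightarrow> subalgebra (natural_filtration M X t) (natural_filtration M X s)"
  by (simp add: subalgebra_def natural_filtration_mono)

lemma subalgebra_natural_filtration:
  "(\<And>u. 0 \<le> u \<Longrightarrow> u \<le> t \<Longrightarrow> X u \<in> borel_measurable M) \<Longrightarrow> subalgebra M (natural_filtration M X t)"
  by (simp add: subalgebra_def sets_natural_filtration_subset)

lemma saturated_filtration_mono:
  "s \<le> t \<Longrightarrow> sets (saturated_filtration M X s) \<subseteq> sets (saturated_filtration M X t)"
  unfolding sets_saturated_filtration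
  by (intro sigma_sets_mono') (use natural_filtration_mono[of s t M X] in auto)

lemma natural_subset_saturated:
  "sets (natural_filtration M X t) \<subseteq> sets (saturated_filtration M X t)"
  by (auto simp: sets_saturated_filtration)

lemma null_subset_saturated:
  "null_sets (completion M) \<subseteq> sets (saturated_filtration M X t)"
  by (auto simp: sets_saturated_filtration)

lemma sets_generated_filtration:
  "sets (generated_filtration M X t) = (\<Inter>s\<in>{t<..}. sets (saturated_filtration M X s))"
proof -
  let ?I = "\<Inter>s\<in>{t<..}. sets (saturated_filtration M X s)"
  have sub: "A \<subseteq> space M" if "A \<in> ?I" for A
    using that sets.sets_into_space[of A "saturated_filtration M X (t + 1)"] by auto
  have "sigma_sets (space M) ?I \<subseteq> ?I"
  proof (intro INT_greatest)
    fix s assume "s \<in> {t<..}"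
    then have "?I \<subseteq> sets (saturated_filtration M X s)" by blast
    then show "sigma_sets (space M) ?I \<subseteq> sets (saturated_filtration M X s)"
      using sets.sigma_sets_subset[of ?I "saturated_filtration M X s"] by simp
  qed
  then have "sigma_sets (space M) ?I = ?I" by (auto intro: sigma_sets.Basic)
  moreover have "sets (generated_filtration M X t) = sigma_sets (space M) ?I"
    unfolding generated_filtration_def by (rule sets_measure_of) (use sub in blast)
  ultimately show ?thesis by simp
qed

lemma space_generated_filtration [simp]: "space (generated_filtration M X t) = space M"
proof -
  have "A \<subseteq> space M" if "A \<in> (\<Inter>s\<in>{t<..}. sets (saturated_filtration M X s))" for A
    using that sets.sets_into_space[of A "saturated_filtration M X (t + 1)"] by auto
  then show ?thesis unfolding generated_filtration_def by (intro space_measure_of) blast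
qed

lemma saturated_subset_generated:
  "sets (saturated_filtration M X t) \<subseteq> sets (generated_filtration M X t)"
  unfolding sets_generated_filtration
  by (intro INT_greatest saturated_filtration_mono) simp

text \<open>The sets that agree almost everywhere with some set of the target natural filtration are
  closed under complements and countable unions and include the generators and the null sets. This
  removes the completion and, at the same time, exchanges a process for a version of it.\<close>

lemma saturated_filtration_AE_eq:
  assumes XY: "\<And>u. 0 \<le> u \<Longrightarrow> u \<le> t \<Longrightarrow> AE \<omega> in completion M. X u \<omega> = Y u \<omega>"
    and A: "A \<in> sets (saturated_filtration M X t)"
  shows "\<exists>A'\<in>sets (natural_filtration M Y t). AE \<omega> in completion M. \<omega> \<in> A \<longleftrightarrow> \<omega> \<in> A'"
proof -
  let ?P = "\<lambda>A. \<exists>A'\<in>sets (natural_filtration M Y t). AE \<omega> in completion M. \<omega> \<in> A \<longleftrightarrow> \<omega> \<in> A'"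
  have compl: "?P (space M - A)" if A: "?P A" for A
  proof -
    obtain A' where "A' \<in> sets (natural_filtration M Y t)" "AE \<omega> in completion M. \<omega> \<in> A \<longleftrightarrow> \<omega> \<in> A'"
      using A by blast
    then show ?thesis
      by (intro bexI[of _ "space M - A'"])
        (use sets.compl_sets[of A' "natural_filtration M Y t"] in auto)
  qed
  have union: "?P (\<Union>i. A i)" if A: "\<And>i::nat. ?P (A i)" for A
  proof -
    obtain A' where "\<And>i. A' i \<in> sets (natural_filtration M Y t)"
      "\<And>i. AE \<omega> in completion M. \<omega> \<in> A i \<longleftrightarrow> \<omega> \<in> A' i"
      using A by metis
    moreover from this(2) have "AE \<omega> in completion M. \<forall>i. \<omega> \<in> A i \<longleftrightarrow> \<omega> \<in> A' i"
      by (simp add: AE_all_countable)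
    ultimately show ?thesis
      by (intro bexI[of _ "\<Union>i. A' i"]) auto
  qed
  have empty: "?P {}" by (intro bexI[of _ "{}"]) auto
  have nat: "?P A" if "A \<in> sets (natural_filtration M X t)" for A
    using that unfolding sets_natural_filtration[of M X t]
  proof induction
    case (Basic A)
    then obtain u C where u: "0 \<le> u" "u \<le> t" "C \<in> sets borel" "A = X u -` C \<inter> space M" by auto
    then have "Y u -` C \<inter> space M \<in> sets (natural_filtration M Y t)"
      by (auto simp: sets_natural_filtration)
    then show ?case
      by (intro bexI[of _ "Y u -` C \<inter> space M"]) (use XY[OF u(1,2)] u(4) in auto)
  qed (fact empty, erule compl, erule union)
  show ?thesis
    using A unfolding sets_saturated_filtration
  proof induction
    case (Basic A)
    then show ?case
    proof
      assume "A \<in> null_sets (completion M)"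
      then show ?thesis by (intro bexI[of _ "{}"]) (auto dest: AE_not_in)
    qed (rule nat)
  qed (fact empty, erule compl, erule union)
qed

text \<open>The product rule only involves probabilities, which do not change when events are
  modified on null sets. This carries independence over to versions of \<open>B\<close> and
  \<open>\<epsilon>\<close>.\<close>

lemma (in prob_space) indep_set_AE_eq:
  assumes ind: "indep_set \<A> \<B>" and ev: "\<A>' \<subseteq> events" "\<B>' \<subseteq> events"
    and A: "\<And>a. a \<in> \<A>' \<Longrightarrow> \<exists>a'\<in>\<A>. AE \<omega> in M. \<omega> \<in> a \<longleftrightarrow> \<omega> \<in> a'"
    and B: "\<And>b. b \<in> \<B>' \<Longrightarrow> \<exists>b'\<in>\<B>. AE \<omega> in M. \<omega> \<in> b \<longleftrightarrow> \<omega> \<in> b'"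
  shows "indep_set \<A>' \<B>'"
proof (rule indep_setI[OF ev])
  fix a b assume ab: "a \<in> \<A>'" "b \<in> \<B>'"
  obtain a' b' where a': "a' \<in> \<A>" "AE \<omega> in M. \<omega> \<in> a \<longleftrightarrow> \<omega> \<in> a'"
    and b': "b' \<in> \<B>" "AE \<omega> in M. \<omega> \<in> b \<longleftrightarrow> \<omega> \<in> b'"
    using A[OF ab(1)] B[OF ab(2)] by blast
  have [measurable]: "a \<in> events" "b \<in> events" "a' \<in> events" "b' \<in> events"
    using ab ev a'(1) b'(1) indep_setD_ev1[OF ind] indep_setD_ev2[OF ind] by auto
  have "prob (a \<inter> b) = prob (a' \<inter> b')"
    by (rule finite_measure_eq_AE) (use a'(2) b'(2) in \<open>auto\<close>)
  also have "\<dots> = prob a' * prob b'" by (rule indep_setD[OF ind a'(1) b'(1)])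
  also have "prob a' = prob a" by (rule finite_measure_eq_AE) (use a'(2) in auto)
  also have "prob b' = prob b" by (rule finite_measure_eq_AE) (use b'(2) in auto)
  finally show "prob (a \<inter> b) = prob a * prob b" .
qed

section \<open>Independence in integral form, and normal laws through characteristic
  functions\<close>

lemma sets_vimage_borel: "sets (vimage_algebra X R borel) = {R -` A \<inter> X | A. A \<in> sets borel}"
  by (rule sets_vimage_algebra2) auto

text \<open>The identity, read as a map into \<open>F\<close>, pushes \<open>M\<close> to its
  restriction to \<open>F\<close>. Independence says that its joint law with \<open>R\<close> is a
  product, checked on rectangles, so Tonelli allows the past to be frozen while \<open>R\<close> is
  integrated out.\<close>

lemma (in prob_space) nn_integral_indep_set:
  assumes F: "subalgebra M F" and R[measurable]: "R \<in> borel_measurable M"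
    and ind: "indep_set (sets F) (sets (vimage_algebra (space M) R borel))"
    and \<phi>[measurable]: "case_prod \<phi> \<in> borel_measurable (F \<Otimes>\<^sub>M borel)"
  shows "(\<integral>\<^sup>+\<omega>. \<phi> \<omega> (R \<omega>) \<partial>M) = (\<integral>\<^sup>+\<omega>. (\<integral>\<^sup>+y. \<phi> \<omega> y \<partial>distr M borel R) \<partial>M)"
proof -
  have id[measurable]: "(\<lambda>\<omega>. \<omega>) \<in> M \<rightarrow>\<^sub>M F" by (rule measurable_from_subalg[OF F]) simp
  interpret R: prob_space "distr M borel R" by (rule prob_space_distr) simp
  interpret F: prob_space "distr M F (\<lambda>\<omega>. \<omega>)" by (rule prob_space_distr) simp
  have "distr M F (\<lambda>\<omega>. \<omega>) \<Otimes>\<^sub>M distr M borel R = distr M (F \<Otimes>\<^sub>M borel) (\<lambda>\<omega>. (\<omega>, R \<omega>))"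
  proof (rule pair_measure_eqI)
    fix A C assume "A \<in> sets (distr M F (\<lambda>\<omega>. \<omega>))" "C \<in> sets (distr M borel R)"
    then have AC[measurable]: "A \<in> sets F" "C \<in> sets borel" by auto
    have [measurable]: "A \<in> events" using AC F by (auto simp: subalgebra_def)
    have "R -` C \<inter> space M \<in> sets (vimage_algebra (space M) R borel)"
      using AC by (auto simp: sets_vimage_borel)
    from indep_setD[OF ind AC(1) this]
    have "emeasure M (A \<inter> (R -` C \<inter> space M)) = emeasure M A * emeasure M (R -` C \<inter> space M)"
      by (simp add: emeasure_eq_measure ennreal_mult)
    moreover have "(\<lambda>\<omega>. (\<omega>, R \<omega>)) -` (A \<times> C) \<inter> space M = A \<inter> (R -` C \<inter> space M)" by auto
    moreover have "(\<lambda>\<omega>. \<omega>) -` A \<inter> space M = A"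
      using sets.sets_into_space[OF \<open>A \<in> events\<close>] by auto
    ultimately show "emeasure (distr M F (\<lambda>\<omega>. \<omega>)) A * emeasure (distr M borel R) C =
      emeasure (distr M (F \<Otimes>\<^sub>M borel) (\<lambda>\<omega>. (\<omega>, R \<omega>))) (A \<times> C)"
      by (simp add: emeasure_distr)
  qed (auto intro: F.sigma_finite_measure_axioms R.sigma_finite_measure_axioms sets_pair_measure_cong)
  note eq = this
  have "(\<integral>\<^sup>+\<omega>. \<phi> \<omega> (R \<omega>) \<partial>M) = (\<integral>\<^sup>+p. case_prod \<phi> p \<partial>distr M (F \<Otimes>\<^sub>M borel) (\<lambda>\<omega>. (\<omega>, R \<omega>)))"
    by (subst nn_integral_distr) auto
  also have "\<dots> = (\<integral>\<^sup>+\<omega>. (\<integral>\<^sup>+y. \<phi> \<omega> y \<partial>distr M borel R) \<partial>distr M F (\<lambda>\<omega>. \<omega>))"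
    unfolding eq[symmetric] by (subst R.nn_integral_fst[symmetric]) auto
  also have "\<dots> = (\<integral>\<^sup>+\<omega>. (\<integral>\<^sup>+y. \<phi> \<omega> y \<partial>distr M borel R) \<partial>M)"
    by (subst nn_integral_distr) auto
  finally show ?thesis .
qed

lemma (in prob_space) integral_indep_set_mult:
  fixes f :: "'a \<Rightarrow> complex"
  assumes F: "subalgebra M F" and R[measurable]: "R \<in> borel_measurable M"
    and ind: "indep_set (sets F) (sets (vimage_algebra (space M) R borel))"
    and f: "f \<in> borel_measurable F" "integrable M f"
    and g[measurable]: "g \<in> borel_measurable borel" and gi: "integrable M (\<lambda>\<omega>. g (R \<omega>))"
  shows "(\<integral>\<omega>. f \<omega> * g (R \<omega>) \<partial>M) = (\<integral>\<omega>. f \<omega> \<partial>M) * (\<integral>\<omega>. g (R \<omega>) \<partial>M)"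
proof (rule indep_var_lebesgue_integral[OF _ f(2) gi])
  have F': "sets F \<subseteq> events" "space F = space M" using F by (auto simp: subalgebra_def)
  have 1: "sigma_sets (space M) {f -` A \<inter> space M |A. A \<in> sets borel} \<subseteq> sets F"
    unfolding F'(2)[symmetric] by (rule sets.sigma_sets_subset) (auto intro: measurable_sets f(1))
  have "(\<lambda>\<omega>. g (R \<omega>)) -` A \<inter> space M \<in> sets (vimage_algebra (space M) R borel)"
    if "A \<in> sets borel" for A
    unfolding sets_vimage_borel using measurable_sets[OF g that]
    by (auto intro!: exI[of _ "g -` A"])
  then have 2: "sigma_sets (space M) {(\<lambda>\<omega>. g (R \<omega>)) -` A \<inter> space M |A. A \<in> sets borel}
      \<subseteq> sets (vimage_algebra (space M) R borel)"
    by (subst space_vimage_algebra[of "space M" R borel, symmetric])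
      (rule sets.sigma_sets_subset, auto)
  show "indep_var borel f borel (\<lambda>\<omega>. g (R \<omega>))"
    unfolding indep_var_eq
    using measurable_from_subalg[OF F f(1)] 1 2 ind indep_setD[OF ind] indep_setD_ev1[OF ind] indep_setD_ev2[OF ind]
    by (auto intro!: indep_setI)
qed

lemma (in prob_space) char_centered_normal:
  assumes \<sigma>: "0 < \<sigma>" and X: "distributed M lborel X (normal_density 0 \<sigma>)"
  shows "(\<integral>\<omega>. iexp (l * X \<omega>) \<partial>M) = exp (- (l * \<sigma>)\<^sup>2 / 2)"
proof -
  have [measurable]: "X \<in> borel_measurable M"
    using distributed_measurable[OF X] by simp
  have "distributed M lborel (\<lambda>\<omega>. X \<omega> / \<sigma>) std_normal_density"
    using normal_standard_normal_convert[OF \<sigma>, of X 0] X by simp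
  then have "std_normal_distribution = distr M lborel (\<lambda>\<omega>. X \<omega> / \<sigma>)"
    by (simp add: distributed_def)
  then have "char std_normal_distribution (l * \<sigma>) = (\<integral>\<omega>. iexp (l * X \<omega>) \<partial>M)"
    unfolding char_def using \<sigma> by (subst \<open>std_normal_distribution = _\<close>, subst integral_distr) auto
  then show ?thesis by (simp add: char_std_normal_distribution)
qed

lemma cmod_iexp [simp]: "cmod (iexp x) = 1"
  by simp

text \<open>For \<open>A\<close> of positive probability the hypothesis gives the characteristic
  function of \<open>X\<close> under the conditional probability \<open>Q\<close> given
  \<open>A\<close>. By Levy uniqueness this conditional law is the same normal law for every such
  \<open>A\<close>, which is independence; taking \<open>A = space M\<close> gives the law
  itself.\<close>

lemma (in prob_space) indep_normal_of_char:
  assumes \<sigma>: "0 < \<sigma>" and X[measurable]: "X \<in> borel_measurable M"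
    and \<A>: "\<A> \<subseteq> events" "space M \<in> \<A>"
    and char: "\<And>A l. A \<in> \<A> \<Longrightarrow>
      (\<integral>\<omega>. indicator A \<omega> * iexp (l * X \<omega>) \<partial>M) = prob A * exp (- (l * \<sigma>)\<^sup>2 / 2)"
  shows "distributed M lborel X (normal_density 0 \<sigma>)"
    and "indep_set \<A> (sets (vimage_algebra (space M) X borel))"
proof -
  let ?N = "density lborel (normal_density 0 \<sigma>)"
  interpret N: prob_space ?N by (rule prob_space_normal_density[OF \<sigma>])
  have N_char: "char ?N l = exp (- (l * \<sigma>)\<^sup>2 / 2)" for l
    unfolding char_def
    by (rule N.char_centered_normal[OF \<sigma>]) (auto simp: distributed_def distr_id2)
  have law: "prob (A \<inter> (X -` C \<inter> space M)) = prob A * measure ?N C"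
    if A: "A \<in> \<A>" and C[measurable]: "C \<in> sets borel" for A C
  proof (cases "prob A = 0")
    case True
    then have "prob (A \<inter> (X -` C \<inter> space M)) = 0"
      using A \<A> finite_measure_mono[of "A \<inter> (X -` C \<inter> space M)" A] measure_nonneg[of M]
      by (metis Int_lower1 antisym subsetD)
    then show ?thesis using True by simp
  next
    case False
    then have pos: "prob A > 0" by (simp add: zero_less_measure_iff)
    have [measurable]: "A \<in> events" using A \<A> by auto
    define Q where "Q = density M (\<lambda>\<omega>. ennreal (indicator A \<omega> / prob A))"
    have emQ: "emeasure Q D = ennreal (prob (A \<inter> D) / prob A)" if [measurable]: "D \<in> events" for D
    proof -
      have "emeasure Q D = (\<integral>\<^sup>+\<omega>. ennreal (1 / prob A) * indicator (A \<inter> D) \<omega> \<partial>M)"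
        unfolding Q_def by (subst emeasure_density)
          (auto intro!: nn_integral_cong split: split_indicator)
      also have "\<dots> = ennreal (1 / prob A) * emeasure M (A \<inter> D)"
        by (subst nn_integral_cmult_indicator) auto
      also have "\<dots> = ennreal (prob (A \<inter> D) / prob A)"
        by (simp add: emeasure_eq_measure ennreal_mult'[symmetric])
      finally show ?thesis .
    qed
    interpret Q: prob_space Q
      by (rule prob_spaceI) (use emQ[of "space M"] pos sets.sets_into_space[OF \<open>A \<in> events\<close>] in
        \<open>simp add: Q_def Int_absorb2\<close>)
    have [measurable]: "X \<in> borel_measurable Q" by (simp add: Q_def)
    have "char (distr Q borel X) l = char ?N l" for l
    proof -
      have "char (distr Q borel X) l = (\<integral>\<omega>. iexp (l * X \<omega>) \<partial>Q)"
        unfolding char_def by (subst integral_distr) auto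
      also have "\<dots> = (\<integral>\<omega>. (indicator A \<omega> / prob A) *\<^sub>R iexp (l * X \<omega>) \<partial>M)"
        unfolding Q_def by (subst integral_density) auto
      also have "\<dots> = (\<integral>\<omega>. (indicator A \<omega> * iexp (l * X \<omega>)) / prob A \<partial>M)"
        by (intro Bochner_Integration.integral_cong) (auto split: split_indicator simp: scaleR_conv_of_real divide_simps)
      also have "\<dots> = char ?N l"
        using char[OF A, of l] pos by (simp add: N_char)
      finally show ?thesis .
    qed
    then have "distr Q borel X = distr ?N borel (\<lambda>x. x)"
      by (intro Levy_uniqueness ext) 
        (auto simp: real_distribution_def real_distribution_axioms_def char_def integral_distr
          intro!: Q.prob_space_distr N.prob_space_distr)
    then have "emeasure (distr Q borel X) C = emeasure (distr ?N borel (\<lambda>x. x)) C" by simp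
    then have "emeasure Q (X -` C \<inter> space M) = emeasure ?N C"
      by (subst (asm) (1 2) emeasure_distr) (auto simp: Q_def)
    then have "prob (A \<inter> (X -` C \<inter> space M)) / prob A = measure ?N C"
      by (subst (asm) emQ) (auto simp: N.emeasure_eq_measure)
    then show ?thesis using pos by (simp add: field_simps)
  qed
  have d: "prob (X -` C \<inter> space M) = measure ?N C" if "C \<in> sets borel" for C
    using law[OF \<A>(2) that] prob_space by (simp add: Int_absorb1)
  show "distributed M lborel X (normal_density 0 \<sigma>)"
    unfolding distributed_def
    by (auto intro!: measure_eqI simp: emeasure_distr emeasure_eq_measure N.emeasure_eq_measure d)
  show "indep_set \<A> (sets (vimage_algebra (space M) X borel))"
    by (rule indep_setI) (use \<A> law d in \<open>auto simp: sets_vimage_borel\<close>)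
qed

section \<open>Girsanov symmetry and the filter\<close>

text \<open>Finite-dimensional rectangles are stable under intersection, as uniqueness of measures
  demands, and their indicators are products over the times in \<open>J\<close>, the shape in which
  the path enters \<open>tilted_symmetry\<close>.\<close>

definition cylinder_sets :: "'a measure \<Rightarrow> (real \<Rightarrow> 'a \<Rightarrow> real) \<Rightarrow> real \<Rightarrow> 'a set set" where
  "cylinder_sets M X t =
     {{\<omega> \<in> space M. \<forall>u\<in>J. X u \<omega> \<in> C u} | J C.
        finite J \<and> J \<subseteq> {0..t} \<and> (\<forall>u. C u \<in> sets borel)}"

lemma Int_stable_cylinder_sets: "Int_stable (cylinder_sets M X t)"
proof (rule Int_stableI)
  fix a b assume "a \<in> cylinder_sets M X t" "b \<in> cylinder_sets M X t"
  then obtain J C K D where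
    a: "a = {\<omega> \<in> space M. \<forall>u\<in>J. X u \<omega> \<in> C u}" "finite J" "J \<subseteq> {0..t}" "\<And>u. C u \<in> sets borel" and
    b: "b = {\<omega> \<in> space M. \<forall>u\<in>K. X u \<omega> \<in> D u}" "finite K" "K \<subseteq> {0..t}" "\<And>u. D u \<in> sets borel"
    unfolding cylinder_sets_def by blast
  let ?E = "\<lambda>u. (if u \<in> J then C u else UNIV) \<inter> (if u \<in> K then D u else UNIV)"
  have "a \<inter> b = {\<omega> \<in> space M. \<forall>u\<in>J \<union> K. X u \<omega> \<in> ?E u}"
    unfolding a b by (auto split: if_splits)
  then show "a \<inter> b \<in> cylinder_sets M X t"
    unfolding cylinder_sets_def using a b by (intro CollectI exI[of _ "J \<union> K"] exI[of _ ?E]) auto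
qed

lemma sets_natural_filtration_cylinder:
  "sets (natural_filtration M X t) = sigma_sets (space M) (cylinder_sets M X t)"
proof (rule antisym)
  show "sets (natural_filtration M X t) \<subseteq> sigma_sets (space M) (cylinder_sets M X t)"
    unfolding sets_natural_filtration
  proof (rule sigma_sets_mono', safe)
    fix u and A :: "real set" assume "0 \<le> u" "u \<le> t" "A \<in> sets borel"
    then show "X u -` A \<inter> space M \<in> cylinder_sets M X t"
      unfolding cylinder_sets_def by (intro CollectI exI[of _ "{u}"] exI[of _ "\<lambda>_. A"]) auto
  qed
  have "cylinder_sets M X t \<subseteq> sets (natural_filtration M X t)"
  proof
    fix a assume "a \<in> cylinder_sets M X t"
    then obtain J C where a: "a = {\<omega> \<in> space M. \<forall>u\<in>J. X u \<omega> \<in> C u}"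
      and J: "finite J" "J \<subseteq> {0..t}" "\<And>u. C u \<in> sets borel"
      unfolding cylinder_sets_def by blast
    have "{\<omega> \<in> space (natural_filtration M X t). \<forall>u\<in>J. X u \<omega> \<in> C u} \<in> sets (natural_filtration M X t)"
    proof (rule sets.sets_Collect_finite_All[OF _ J(1)])
      fix u assume "u \<in> J"
      then have "X u \<in> borel_measurable (natural_filtration M X t)"
        using J by (intro measurable_natural_filtration) auto
      then show "{\<omega> \<in> space (natural_filtration M X t). X u \<omega> \<in> C u} \<in> sets (natural_filtration M X t)"
        using J(3)[of u] by measurable
    qed
    then show "a \<in> sets (natural_filtration M X t)" by (simp add: a)
  qed
  then show "sigma_sets (space M) (cylinder_sets M X t) \<subseteq> sets (natural_filtration M X t)"
    using sets.sigma_sets_subset[of _ "natural_filtration M X t"] by simp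
qed

section \<open>The hyperbolic tangent and exponential tilting of Gaussian transitions\<close>

lemma cosh_times_one_minus_tanh: "(1 - tanh x) * cosh x = exp (- (x::real))"
proof -
  have "tanh x * cosh x = sinh x" by (simp add: tanh_def)
  then show ?thesis by (simp add: left_diff_distrib cosh_minus_sinh)
qed

lemma abs_tanh_le_1: "\<bar>tanh (x::real)\<bar> \<le> 1"
  using tanh_real_bounds[of x] by auto

lemma measurable_tanh_real [measurable]: "(tanh :: real \<Rightarrow> real) \<in> borel_measurable borel"
  by (rule borel_measurable_continuous_onI) (intro continuous_intros, auto)

lemma prod_indicator_cylinder:
  "finite J \<Longrightarrow> (\<Prod>u\<in>J. indicator (C u) (x u)) = (indicator {y. \<forall>u\<in>J. y u \<in> C u} x :: ennreal)"
  by (induction J rule: finite_induct) (auto split: split_indicator)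

text \<open>Completing the square: the weight cancels the drift \<open>\<mu> * d\<close>, and the
  sign \<open>e\<close> disappears into the symmetry of the centred normal density. Apart from the
  weight at \<open>x\<close>, the result depends on \<open>e\<close> and \<open>x\<close> only
  through \<open>e * x\<close>, so one kernel serves both reflections.\<close>

lemma nn_integral_normal_tilt:
  fixes h :: "real \<Rightarrow> ennreal"
  assumes d: "d > 0" and e: "e = 1 \<or> e = (-1::real)" and h[measurable]: "h \<in> borel_measurable borel"
  shows "(\<integral>\<^sup>+y. normal_density 0 (sqrt d) y * (h (e * (x + y + \<mu> * d)) * exp (- \<mu> * (x + y + \<mu> * d))) \<partial>lborel)
    = exp (- \<mu> * x) * (exp (- \<mu>\<^sup>2 * d / 2) * (\<integral>\<^sup>+z. normal_density 0 (sqrt d) z * h (e * x + z) \<partial>lborel))"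
proof -
  have e2: "e * e = 1" "\<bar>e\<bar> = 1" "e \<noteq> 0" using e by auto
  have dens: "normal_density 0 (sqrt d) (- \<mu> * d + e * z) * exp (- \<mu> * (x + e * z))
      = exp (- \<mu> * x) * exp (- \<mu>\<^sup>2 * d / 2) * normal_density 0 (sqrt d) z" for z
  proof -
    have "- (- \<mu> * d + e * z)\<^sup>2 / (2 * d) + (- \<mu> * (x + e * z)) = - \<mu> * x + (- \<mu>\<^sup>2 * d / 2) + (- z\<^sup>2 / (2 * d))"
      using d e by (auto simp: field_simps power2_eq_square)
    then show ?thesis
      using d by (simp add: normal_density_def exp_add[symmetric] field_simps)
  qed
  have arg: "e * (x + (- \<mu> * d + e * z) + \<mu> * d) = e * x + z" "x + (- \<mu> * d + e * z) + \<mu> * d = x + e * z"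
      "e * (x + e * z) = e * x + z" for z
    using e by auto
  \<comment> \<open>Substitution of \<open>- \<mu> * d + e * z\<close> for \<open>y\<close>; the
    Jacobian is \<open>\<bar>e\<bar> = 1\<close>.\<close>
  have "(\<integral>\<^sup>+y. normal_density 0 (sqrt d) y * (h (e * (x + y + \<mu> * d)) * exp (- \<mu> * (x + y + \<mu> * d))) \<partial>lborel)
    = (\<integral>\<^sup>+z. normal_density 0 (sqrt d) (- \<mu> * d + e * z) * (h (e * x + z) * exp (- \<mu> * (x + e * z))) \<partial>lborel)"
    by (subst nn_integral_real_affine[OF _ e2(3), of _ "- \<mu> * d"]) (simp_all only: arg e2, simp_all add: arg(3))
  also have "\<dots> = (\<integral>\<^sup>+z. ennreal (exp (- \<mu> * x) * exp (- \<mu>\<^sup>2 * d / 2)) * (normal_density 0 (sqrt d) z * h (e * x + z)) \<partial>lborel)"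
  proof (rule nn_integral_cong)
    fix z
    have "ennreal (normal_density 0 (sqrt d) (- \<mu> * d + e * z)) * (h (e * x + z) * exp (- \<mu> * (x + e * z)))
      = ennreal (normal_density 0 (sqrt d) (- \<mu> * d + e * z) * exp (- \<mu> * (x + e * z))) * h (e * x + z)"
      by (subst ennreal_mult) (auto simp: ac_simps)
    also have "\<dots> = ennreal (exp (- \<mu> * x) * exp (- \<mu>\<^sup>2 * d / 2)) * (normal_density 0 (sqrt d) z * h (e * x + z))"
      unfolding dens by (subst ennreal_mult) (auto simp: ac_simps)
    finally show "ennreal (normal_density 0 (sqrt d) (- \<mu> * d + e * z)) * (h (e * x + z) * exp (- \<mu> * (x + e * z)))
      = ennreal (exp (- \<mu> * x) * exp (- \<mu>\<^sup>2 * d / 2)) * (normal_density 0 (sqrt d) z * h (e * x + z))" .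
  qed
  also have "\<dots> = ennreal (exp (- \<mu> * x) * exp (- \<mu>\<^sup>2 * d / 2)) * (\<integral>\<^sup>+z. normal_density 0 (sqrt d) z * h (e * x + z) \<partial>lborel)"
    by (rule nn_integral_cmult) auto
  finally show ?thesis by (simp add: ennreal_mult mult.assoc)
qed

text \<open>Path properties hold at every point of the space and on the whole time axis, and the
  sign is exactly 1 or -1. Integrals along paths are then measurable for the uncompleted natural
  filtration of \<open>U\<close>, and null sets stay out of the computation.\<close>

locale brownian_with_sign = prob_space M
  for M :: "'a measure" and B :: "real \<Rightarrow> 'a \<Rightarrow> real" and \<epsilon> :: "'a \<Rightarrow> real" and \<mu> :: real +
  assumes B_meas [measurable]: "B t \<in> borel_measurable M"
    and B_cont: "\<omega> \<in> space M \<Longrightarrow> continuous_on UNIV (\<lambda>t. B t \<omega>)"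
    and B_0: "\<omega> \<in> space M \<Longrightarrow> B 0 \<omega> = 0"
    and B_normal: "0 \<le> s \<Longrightarrow> s < t \<Longrightarrow>
      distributed M lborel (\<lambda>\<omega>. B t \<omega> - B s \<omega>) (normal_density 0 (sqrt (t - s)))"
    and B_indep: "0 \<le> s \<Longrightarrow> s < t \<Longrightarrow>
      indep_set (sets (natural_filtration M B s))
        (sets (vimage_algebra (space M) (\<lambda>\<omega>. B t \<omega> - B s \<omega>) borel))"
    and sign_meas [measurable]: "\<epsilon> \<in> borel_measurable M"
    and sign: "\<omega> \<in> space M \<Longrightarrow> \<epsilon> \<omega> = 1 \<or> \<epsilon> \<omega> = -1"
    and sign_half: "prob {\<omega> \<in> space M. \<epsilon> \<omega> = 1} = 1 / 2"
    and sign_indep: "0 \<le> t \<Longrightarrow>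
      indep_set (sets (natural_filtration M B t)) (sets (vimage_algebra (space M) \<epsilon> borel))"
begin

abbreviation "X \<equiv> \<lambda>t \<omega>. B t \<omega> + \<mu> * t"
abbreviation "U \<equiv> \<lambda>t \<omega>. \<epsilon> \<omega> * X t \<omega>"

lemma subalgebra_B: "subalgebra M (natural_filtration M B t)"
  by (rule subalgebra_natural_filtration) simp

lemma subalgebra_U: "subalgebra M (natural_filtration M U t)"
  by (rule subalgebra_natural_filtration) simp

text \<open>\<open>X t\<close> is \<open>X s\<close> plus an independent increment plus
  \<open>\<mu> * (t - s)\<close>. The past is frozen, the tilt formula is applied to the increment,
  and \<open>Z\<close> carries along the factors that belong to earlier times.\<close>

lemma nn_integral_tilted_step:
  fixes h :: "real \<Rightarrow> ennreal" and Z :: "'a \<Rightarrow> ennreal"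
  assumes st: "0 \<le> s" "s < t" and e: "e = 1 \<or> e = (-1::real)"
    and h[measurable]: "h \<in> borel_measurable borel"
    and Z[measurable]: "Z \<in> borel_measurable (natural_filtration M B s)"
  shows "(\<integral>\<^sup>+\<omega>. h (e * X t \<omega>) * exp (- \<mu> * X t \<omega>) * Z \<omega> \<partial>M) =
    (\<integral>\<^sup>+\<omega>. (exp (- \<mu>\<^sup>2 * (t - s) / 2) * (\<integral>\<^sup>+z. normal_density 0 (sqrt (t - s)) z * h (e * X s \<omega> + z) \<partial>lborel))
       * exp (- \<mu> * X s \<omega>) * Z \<omega> \<partial>M)"
proof -
  let ?d = "t - s"
  let ?F = "natural_filtration M B s"
  have [measurable]: "B s \<in> borel_measurable ?F"
    by (rule measurable_natural_filtration) (use st in auto)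
  define \<phi> where "\<phi> \<omega> y = h (e * (X s \<omega> + y + \<mu> * ?d)) * exp (- \<mu> * (X s \<omega> + y + \<mu> * ?d)) * Z \<omega>" for \<omega> y
  have [measurable]: "case_prod \<phi> \<in> borel_measurable (?F \<Otimes>\<^sub>M borel)"
    unfolding \<phi>_def by measurable
  have X_incr: "X s \<omega> + (B t \<omega> - B s \<omega>) + \<mu> * ?d = X t \<omega>" for \<omega>
    by (simp add: algebra_simps)
  have law: "distr M borel (\<lambda>\<omega>. B t \<omega> - B s \<omega>) = density lborel (normal_density 0 (sqrt ?d))"
  proof -
    have "distr M borel (\<lambda>\<omega>. B t \<omega> - B s \<omega>) = distr M lborel (\<lambda>\<omega>. B t \<omega> - B s \<omega>)"
      by (rule distr_cong) auto
    then show ?thesis using distributed_distr_eq_density[OF B_normal[OF st]] by simp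
  qed
  have "(\<integral>\<^sup>+\<omega>. h (e * X t \<omega>) * exp (- \<mu> * X t \<omega>) * Z \<omega> \<partial>M) = (\<integral>\<^sup>+\<omega>. \<phi> \<omega> (B t \<omega> - B s \<omega>) \<partial>M)"
    unfolding \<phi>_def X_incr ..
  also have "\<dots> = (\<integral>\<^sup>+\<omega>. (\<integral>\<^sup>+y. \<phi> \<omega> y \<partial>distr M borel (\<lambda>\<omega>. B t \<omega> - B s \<omega>)) \<partial>M)"
    by (rule nn_integral_indep_set[OF subalgebra_B _ B_indep[OF st]]) measurable
  also have "\<dots> = (\<integral>\<^sup>+\<omega>. (exp (- \<mu>\<^sup>2 * ?d / 2) * (\<integral>\<^sup>+z. normal_density 0 (sqrt ?d) z * h (e * X s \<omega> + z) \<partial>lborel))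
       * exp (- \<mu> * X s \<omega>) * Z \<omega> \<partial>M)"
  proof (rule nn_integral_cong)
    fix \<omega> assume "\<omega> \<in> space M"
    have "(\<integral>\<^sup>+y. \<phi> \<omega> y \<partial>distr M borel (\<lambda>\<omega>. B t \<omega> - B s \<omega>)) =
      (\<integral>\<^sup>+y. (normal_density 0 (sqrt ?d) y *
         (h (e * (X s \<omega> + y + \<mu> * ?d)) * exp (- \<mu> * (X s \<omega> + y + \<mu> * ?d)))) * Z \<omega> \<partial>lborel)"
      unfolding law \<phi>_def by (subst nn_integral_density) (auto simp: mult.assoc)
    also have "\<dots> = (\<integral>\<^sup>+y. (normal_density 0 (sqrt ?d) y *
         (h (e * (X s \<omega> + y + \<mu> * ?d)) * exp (- \<mu> * (X s \<omega> + y + \<mu> * ?d)))) \<partial>lborel) * Z \<omega>"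
      by (rule nn_integral_multc) measurable
    also have "\<dots> = (exp (- \<mu>\<^sup>2 * ?d / 2) * (\<integral>\<^sup>+z. normal_density 0 (sqrt ?d) z * h (e * X s \<omega> + z) \<partial>lborel))
       * exp (- \<mu> * X s \<omega>) * Z \<omega>"
      using st by (subst nn_integral_normal_tilt[OF _ e h]) (auto simp: ac_simps)
    finally show "(\<integral>\<^sup>+y. \<phi> \<omega> y \<partial>distr M borel (\<lambda>\<omega>. B t \<omega> - B s \<omega>)) = \<dots>" .
  qed
  finally show ?thesis .
qed

text \<open>
  The last time point is integrated out by the tilted transition kernel, which absorbs it into \<open>h\<close> in the same
  way for \<open>X\<close> and \<open>-X\<close>; at time \<open>0\<close> both sides coincide because \<open>X 0 = 0\<close>.
\<close>

lemma tilted_symmetry: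
  fixes h :: "real \<Rightarrow> ennreal" and f :: "real \<Rightarrow> real \<Rightarrow> ennreal"
  assumes "finite J" "J \<subseteq> {0..r}" "0 \<le> r" "h \<in> borel_measurable borel"
    and f: "\<And>u. f u \<in> borel_measurable borel"
  shows "(\<integral>\<^sup>+\<omega>. h (X r \<omega>) * exp (- \<mu> * X r \<omega>) * (\<Prod>u\<in>J. f u (X u \<omega>)) \<partial>M) =
    (\<integral>\<^sup>+\<omega>. h (- X r \<omega>) * exp (- \<mu> * X r \<omega>) * (\<Prod>u\<in>J. f u (- X u \<omega>)) \<partial>M)"
proof -
  \<comment> \<open>\<open>I 1\<close> and \<open>I (-1)\<close> are the two sides of the claim. The
    kernel \<open>P\<close> does not depend on \<open>e\<close>, so a single step argument treats
    both.\<close>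
  define I where "I e r h J = (\<integral>\<^sup>+\<omega>. h (e * X r \<omega>) * ennreal (exp (- \<mu> * X r \<omega>)) * (\<Prod>u\<in>J. f u (e * X u \<omega>)) \<partial>M)"
    for e r J and h :: "real \<Rightarrow> ennreal"
  define P where "P s t h x = ennreal (exp (- \<mu>\<^sup>2 * (t - s) / 2)) * (\<integral>\<^sup>+z. normal_density 0 (sqrt (t - s)) z * h (x + z) \<partial>lborel)"
    for s t x and h :: "real \<Rightarrow> ennreal"
  have P_meas: "P s t h \<in> borel_measurable borel" if [measurable]: "h \<in> borel_measurable borel" for s t h
    unfolding P_def by measurable
  have step: "I e t h J = I e s (P s t h) J"
    if "0 \<le> s" "s < t" "e = 1 \<or> e = -1" "h \<in> borel_measurable borel" "J \<subseteq> {0..s}" for e s t h J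
  proof -
    have "(\<lambda>\<omega>. \<Prod>u\<in>J. f u (e * X u \<omega>)) \<in> borel_measurable (natural_filtration M B s)"
    proof (rule borel_measurable_prod_ennreal)
      fix u assume "u \<in> J"
      then have [measurable]: "B u \<in> borel_measurable (natural_filtration M B s)"
        using that by (intro measurable_natural_filtration) auto
      show "(\<lambda>\<omega>. f u (e * X u \<omega>)) \<in> borel_measurable (natural_filtration M B s)"
        by (intro measurable_compose[OF _ f] borel_measurable_times borel_measurable_add borel_measurable_const) fact
    qed
    from nn_integral_tilted_step[OF that(1-4) this] show ?thesis unfolding I_def P_def .
  qed
  have "I 1 r h J = I (-1) r h J"
    using assms(1-4)
  \<comment> \<open>\<open>r\<close> and \<open>h\<close> vary: a kernel step lowers
    \<open>r\<close> to the largest time \<open>b\<close> of the index set, and the factor at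
    \<open>b\<close> is then multiplied into \<open>h\<close>.\<close>
  proof (induction J arbitrary: r h rule: finite_linorder_max_induct)
    case empty
    show ?case
    proof (cases "r = 0")
      case True
      then show ?thesis unfolding I_def by (intro nn_integral_cong) (auto simp: B_0)
    next
      case False
      then have "I e r h {} = I e 0 (P 0 r h) {}" if "e = 1 \<or> e = -1" for e
        using empty that by (intro step) auto
      moreover have "I 1 0 (P 0 r h) {} = I (-1) 0 (P 0 r h) {}"
        unfolding I_def by (intro nn_integral_cong) (auto simp: B_0)
      ultimately show ?thesis by simp
    qed
  next
    case (insert b A)
    have b: "b \<notin> A" "0 \<le> b" "b \<le> r" "A \<subseteq> {0..b}" using insert by force+
    have absorb: "I e b g (insert b A) = I e b (\<lambda>x. g x * f b x) A" for e g
      unfolding I_def using b insert by (intro nn_integral_cong) (auto simp: ac_simps)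
    have last: "I 1 b g (insert b A) = I (-1) b g (insert b A)" if [measurable]: "g \<in> borel_measurable borel" for g
      unfolding absorb by (rule insert.IH) (use b f[of b] in auto)
    show ?case
    proof (cases "b = r")
      case True
      then show ?thesis using last[OF insert.prems(3)] by simp
    next
      case False
      then have "I e r h (insert b A) = I e b (P b r h) (insert b A)" if "e = 1 \<or> e = -1" for e
        using insert b that by (intro step) auto
      then show ?thesis using last[OF P_meas[OF insert.prems(3)]] by simp
    qed
  qed
  then show ?thesis unfolding I_def by simp
qed

text \<open>The sign is fair and independent of \<open>B\<close>, so it averages the two branches.
  This passes between integrals over the path of \<open>U\<close> and integrals over the path of
  \<open>X\<close>.\<close>

lemma nn_integral_sign_split:
  fixes f g :: "'a \<Rightarrow> ennreal"
  assumes t: "0 \<le> t" and [measurable]: "f \<in> borel_measurable (natural_filtration M B t)"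
    "g \<in> borel_measurable (natural_filtration M B t)"
  shows "2 * (\<integral>\<^sup>+\<omega>. (if \<epsilon> \<omega> = 1 then f \<omega> else g \<omega>) \<partial>M) = (\<integral>\<^sup>+\<omega>. f \<omega> \<partial>M) + (\<integral>\<^sup>+\<omega>. g \<omega> \<partial>M)"
proof -
  have fg: "f \<in> borel_measurable M" "g \<in> borel_measurable M"
    by (rule measurable_from_subalg[OF subalgebra_B], fact)+
  have "{\<omega> \<in> space M. \<epsilon> \<omega> \<noteq> 1} = space M - {\<omega> \<in> space M. \<epsilon> \<omega> = 1}" by auto
  then have "prob {\<omega> \<in> space M. \<epsilon> \<omega> \<noteq> 1} = 1 / 2"
    using sign_half by (simp add: prob_compl)
  then have em: "emeasure M {\<omega> \<in> space M. \<epsilon> \<omega> = 1} = ennreal (1/2)"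
      "emeasure M {\<omega> \<in> space M. \<epsilon> \<omega> \<noteq> 1} = ennreal (1/2)"
    using sign_half by (simp_all only: emeasure_eq_measure)
  have two: "2 * (a * ennreal (1/2)) = a" for a
  proof -
    have "2 * ennreal (1/2) = 1"
      by (metis ennreal_1 ennreal_mult' ennreal_numeral mult.commute nonzero_eq_divide_eq zero_neq_numeral zero_le_numeral)
    then show ?thesis by (metis mult.assoc mult.commute mult_1)
  qed
  have "(\<integral>\<^sup>+\<omega>. (if \<epsilon> \<omega> = 1 then f \<omega> else g \<omega>) \<partial>M) =
    (\<integral>\<^sup>+\<omega>. (\<integral>\<^sup>+y. (if y = 1 then f \<omega> else g \<omega>) \<partial>distr M borel \<epsilon>) \<partial>M)"
    by (rule nn_integral_indep_set[OF subalgebra_B _ sign_indep[OF t]]) measurable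
  also have "\<dots> = (\<integral>\<^sup>+\<omega>. (f \<omega> * ennreal (1/2) + g \<omega> * ennreal (1/2)) \<partial>M)"
  proof (rule nn_integral_cong)
    fix \<omega>
    have "(\<integral>\<^sup>+y. (if y = 1 then f \<omega> else g \<omega>) \<partial>distr M borel \<epsilon>) =
      (\<integral>\<^sup>+x. f \<omega> * indicator {\<omega> \<in> space M. \<epsilon> \<omega> = 1} x + g \<omega> * indicator {\<omega> \<in> space M. \<epsilon> \<omega> \<noteq> 1} x \<partial>M)"
      by (subst nn_integral_distr) (auto intro!: nn_integral_cong)
    also have "\<dots> = f \<omega> * ennreal (1/2) + g \<omega> * ennreal (1/2)"
      by (subst nn_integral_add) (auto simp: nn_integral_cmult_indicator em)
    finally show "(\<integral>\<^sup>+y. (if y = 1 then f \<omega> else g \<omega>) \<partial>distr M borel \<epsilon>) = \<dots>" .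
  qed
  also have "\<dots> = (\<integral>\<^sup>+\<omega>. f \<omega> \<partial>M) * ennreal (1/2) + (\<integral>\<^sup>+\<omega>. g \<omega> \<partial>M) * ennreal (1/2)"
    using fg by (subst nn_integral_add) (auto simp: nn_integral_multc)
  finally show ?thesis by (simp only: distrib_left two)
qed

text \<open>
  The weight \<open>exp (- x)\<close> of the symmetry enters through \<open>1 - tanh x = exp (- x) / cosh x\<close>.
\<close>

lemma nn_integral_filter_cylinder:
  assumes r: "0 \<le> r" and A: "A \<in> cylinder_sets M U r"
  shows "(\<integral>\<^sup>+\<omega>. ennreal (1 + \<epsilon> \<omega>) * indicator A \<omega> \<partial>M) =
    (\<integral>\<^sup>+\<omega>. ennreal (1 + tanh (\<mu> * U r \<omega>)) * indicator A \<omega> \<partial>M)"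
proof -
  obtain J C where A: "A = {\<omega> \<in> space M. \<forall>u\<in>J. U u \<omega> \<in> C u}"
      and J: "finite J" "J \<subseteq> {0..r}" and C[measurable]: "\<And>u. C u \<in> sets borel"
    using A unfolding cylinder_sets_def by blast
  let ?F = "natural_filtration M B r"
  \<comment> \<open>The indicator of the cylinder with the sign frozen at \<open>e\<close>, hence a
    function of \<open>B\<close> alone.\<close>
  define p where "p e \<omega> = (\<Prod>u\<in>J. indicator (C u) (e * X u \<omega>) :: ennreal)" for e \<omega>
  have [measurable]: "p e \<in> borel_measurable ?F" for e
    unfolding p_def
  proof (rule borel_measurable_prod_ennreal)
    fix u assume "u \<in> J"
    then have [measurable]: "B u \<in> borel_measurable ?F"
      using J by (intro measurable_natural_filtration) auto
    show "(\<lambda>\<omega>. indicator (C u) (e * X u \<omega>)) \<in> borel_measurable ?F"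
      by (intro measurable_compose[OF _ borel_measurable_indicator[OF C]]
          borel_measurable_times borel_measurable_add borel_measurable_const) fact
  qed
  have [measurable]: "B r \<in> borel_measurable ?F"
    by (rule measurable_natural_filtration) (use r in auto)
  have ind: "indicator A \<omega> = p (\<epsilon> \<omega>) \<omega>" if "\<omega> \<in> space M" for \<omega>
    using that unfolding p_def A prod_indicator_cylinder[OF J(1), of C] by (auto split: split_indicator)
  have th: "1 - tanh (\<mu> * x) \<ge> 0" "1 + tanh (\<mu> * x) \<ge> 0" for x :: real
    using abs_tanh_le_1[of "\<mu> * x"] by auto
  have tilt: "ennreal (1 - tanh (\<mu> * x)) = ennreal (1 / cosh (\<mu> * x)) * exp (- \<mu> * x)" for x :: real
  proof -
    have "1 - tanh (\<mu> * x) = 1 / cosh (\<mu> * x) * exp (- \<mu> * x)"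
      using cosh_times_one_minus_tanh[of "\<mu> * x"] cosh_real_pos[of "\<mu> * x"]
      by (simp add: eq_divide_eq)
    then show ?thesis using cosh_real_pos[of "\<mu> * x"] by (simp only: ennreal_mult'[symmetric] less_imp_le exp_ge_zero)
      (subst ennreal_mult[symmetric], simp_all)
  qed
  \<comment> \<open>The choice \<open>h = 1 / cosh\<close> is even, so the reflection acts only on
    the cylinder indicator and leaves the factor \<open>1 - tanh\<close> as it is.\<close>
  have sym: "(\<integral>\<^sup>+\<omega>. ennreal (1 - tanh (\<mu> * X r \<omega>)) * p (-1) \<omega> \<partial>M) =
    (\<integral>\<^sup>+\<omega>. ennreal (1 - tanh (\<mu> * X r \<omega>)) * p 1 \<omega> \<partial>M)"
    unfolding tilt p_def
    using tilted_symmetry[OF J r, of "\<lambda>x. ennreal (1 / cosh (\<mu> * x))" "\<lambda>u. indicator (C u)"]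
    by (simp add: borel_measurable_continuous_onI continuous_intros mult_minus_right
        del: minus_add_distrib)
  have "2 * (\<integral>\<^sup>+\<omega>. ennreal (1 + \<epsilon> \<omega>) * indicator A \<omega> \<partial>M) =
    2 * (\<integral>\<^sup>+\<omega>. (if \<epsilon> \<omega> = 1 then 2 * p 1 \<omega> else 0) \<partial>M)"
  proof (intro arg_cong2[of _ _ _ _ "(*)"] refl nn_integral_cong)
    fix \<omega> assume "\<omega> \<in> space M"
    then show "ennreal (1 + \<epsilon> \<omega>) * indicator A \<omega> = (if \<epsilon> \<omega> = 1 then 2 * p 1 \<omega> else 0)"
      using sign[of \<omega>] by (auto simp: ind)
  qed
  also have "\<dots> = (\<integral>\<^sup>+\<omega>. 2 * p 1 \<omega> \<partial>M)"
    by (subst nn_integral_sign_split[OF r]) auto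
  \<comment> \<open>The constant 2 is split as (1 + tanh) + (1 - tanh). The symmetry moves the
    second part from sign 1 to sign -1, where \<open>U = - X\<close> turns \<open>1 - tanh\<close>
    of \<open>X\<close> into \<open>1 + tanh\<close> of \<open>U\<close>; both parts then recombine
    into one integral over the signed path.\<close>
  also have "\<dots> = (\<integral>\<^sup>+\<omega>. ennreal (1 + tanh (\<mu> * X r \<omega>)) * p 1 \<omega> + ennreal (1 - tanh (\<mu> * X r \<omega>)) * p 1 \<omega> \<partial>M)"
    unfolding distrib_right[symmetric] by (subst ennreal_plus[symmetric]) (auto simp: less_imp_le[OF tanh_real_lt_1] less_imp_le[OF tanh_real_gt_neg1] th)
  also have "\<dots> = (\<integral>\<^sup>+\<omega>. ennreal (1 + tanh (\<mu> * X r \<omega>)) * p 1 \<omega> \<partial>M) +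
     (\<integral>\<^sup>+\<omega>. ennreal (1 - tanh (\<mu> * X r \<omega>)) * p 1 \<omega> \<partial>M)"
    by (rule nn_integral_add) (rule measurable_from_subalg[OF subalgebra_B], measurable)+
  also have "\<dots> = (\<integral>\<^sup>+\<omega>. ennreal (1 + tanh (\<mu> * X r \<omega>)) * p 1 \<omega> \<partial>M) +
     (\<integral>\<^sup>+\<omega>. ennreal (1 - tanh (\<mu> * X r \<omega>)) * p (-1) \<omega> \<partial>M)"
    by (simp only: sym)
  also have "\<dots> = 2 * (\<integral>\<^sup>+\<omega>. (if \<epsilon> \<omega> = 1 then ennreal (1 + tanh (\<mu> * X r \<omega>)) * p 1 \<omega>
      else ennreal (1 - tanh (\<mu> * X r \<omega>)) * p (-1) \<omega>) \<partial>M)"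
    by (subst nn_integral_sign_split[OF r]) auto
  also have "\<dots> = 2 * (\<integral>\<^sup>+\<omega>. ennreal (1 + tanh (\<mu> * U r \<omega>)) * indicator A \<omega> \<partial>M)"
  proof (intro arg_cong2[of _ _ _ _ "(*)"] refl nn_integral_cong)
    fix \<omega> assume \<omega>: "\<omega> \<in> space M"
    show "(if \<epsilon> \<omega> = 1 then ennreal (1 + tanh (\<mu> * X r \<omega>)) * p 1 \<omega>
      else ennreal (1 - tanh (\<mu> * X r \<omega>)) * p (-1) \<omega>) = ennreal (1 + tanh (\<mu> * U r \<omega>)) * indicator A \<omega>"
    proof (cases "\<epsilon> \<omega> = 1")
      case True
      then show ?thesis by (simp add: ind[OF \<omega>])
    next
      case False
      then have "\<epsilon> \<omega> = -1" using sign[OF \<omega>] by simp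
      moreover from this have "\<mu> * U r \<omega> = - (\<mu> * X r \<omega>)" by (simp add: algebra_simps)
      then have "tanh (\<mu> * U r \<omega>) = - tanh (\<mu> * X r \<omega>)" by (simp only: tanh_minus)
      ultimately show ?thesis by (simp add: ind[OF \<omega>])
    qed
  qed
  finally show ?thesis
    by (simp add: ennreal_mult_cancel_left)
qed

text \<open>Adding 1 makes \<open>\<epsilon>\<close> and \<open>tanh\<close> nonnegative, so both
  define measures on the past of \<open>U\<close>. These agree on cylinders and hence everywhere;
  testing with \<open>\<xi>\<close> and cancelling the common term shows the filter error orthogonal
  to the past, without forming a conditional expectation.\<close>

lemma filter_identity:
  fixes \<xi> :: "'a \<Rightarrow> complex"
  assumes r: "0 \<le> r" and \<xi>[measurable]: "\<xi> \<in> borel_measurable (natural_filtration M U r)"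
    and bd: "\<And>\<omega>. cmod (\<xi> \<omega>) \<le> K"
  shows "(\<integral>\<omega>. \<xi> \<omega> * of_real (\<epsilon> \<omega> - tanh (\<mu> * U r \<omega>)) \<partial>M) = 0"
proof -
  let ?F = "natural_filtration M U r"
  have id[measurable]: "(\<lambda>\<omega>. \<omega>) \<in> M \<rightarrow>\<^sub>M ?F" by (rule measurable_from_subalg[OF subalgebra_U[of r]]) simp
  have [measurable]: "\<xi> \<in> borel_measurable M" by (rule measurable_from_subalg[OF subalgebra_U \<xi>])
  \<comment> \<open>The measure with density \<open>f\<close>, restricted to the past of
    \<open>U\<close>.\<close>
  define D where "D f = distr (density M (\<lambda>\<omega>. ennreal (f \<omega>))) ?F (\<lambda>\<omega>. \<omega>)" for f
  have em: "emeasure (D f) A = (\<integral>\<^sup>+\<omega>. ennreal (f \<omega>) * indicator A \<omega> \<partial>M)"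
    if [measurable]: "A \<in> sets ?F" "f \<in> borel_measurable M" for A f
  proof -
    have "A \<in> sets M" using that subalgebra_U[of r] by (auto simp: subalgebra_def)
    moreover have "(\<lambda>\<omega>. \<omega>) -` A \<inter> space M = A" using sets.sets_into_space[OF \<open>A \<in> sets M\<close>] by auto
    ultimately show ?thesis unfolding D_def by (subst emeasure_distr) (auto simp: emeasure_density)
  qed
  have [measurable]: "cylinder_sets M U r \<subseteq> sets ?F"
    by (auto simp: sets_natural_filtration_cylinder)
  have sp: "space M \<in> cylinder_sets M U r"
    unfolding cylinder_sets_def by (intro CollectI exI[of _ "{}"] exI[of _ "\<lambda>_. UNIV"]) auto
  have "D (\<lambda>\<omega>. 1 + \<epsilon> \<omega>) = D (\<lambda>\<omega>. 1 + tanh (\<mu> * U r \<omega>))"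
  proof (rule measure_eqI_generator_eq[OF Int_stable_cylinder_sets[of M U r], where A="\<lambda>_. space M"])
    show "emeasure (D (\<lambda>\<omega>. 1 + \<epsilon> \<omega>)) A = emeasure (D (\<lambda>\<omega>. 1 + tanh (\<mu> * U r \<omega>))) A"
      if "A \<in> cylinder_sets M U r" for A
      using that nn_integral_filter_cylinder[OF r that] \<open>cylinder_sets M U r \<subseteq> sets ?F\<close>
      by (subst (1 2) em) auto
    have "emeasure (D (\<lambda>\<omega>. 1 + \<epsilon> \<omega>)) (space M) \<le> (\<integral>\<^sup>+\<omega>. 2 \<partial>M)"
    proof (subst em)
      show "(\<integral>\<^sup>+\<omega>. ennreal (1 + \<epsilon> \<omega>) * indicator (space M) \<omega> \<partial>M) \<le> (\<integral>\<^sup>+\<omega>. 2 \<partial>M)"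
      proof (rule nn_integral_mono)
        fix \<omega> assume "\<omega> \<in> space M"
        then show "ennreal (1 + \<epsilon> \<omega>) * indicator (space M) \<omega> \<le> 2"
          using sign[of \<omega>] by auto
      qed
    qed (use sp \<open>cylinder_sets M U r \<subseteq> sets ?F\<close> in auto)
    also have "\<dots> < \<infinity>" by (simp add: emeasure_space_1)
    finally show "emeasure (D (\<lambda>\<omega>. 1 + \<epsilon> \<omega>)) (space M) \<noteq> \<infinity>" by simp
  qed (use sp in \<open>auto simp: D_def sets_natural_filtration_cylinder cylinder_sets_def\<close>)
  then have "(\<integral>\<omega>. \<xi> \<omega> \<partial>D (\<lambda>\<omega>. 1 + \<epsilon> \<omega>)) = (\<integral>\<omega>. \<xi> \<omega> \<partial>D (\<lambda>\<omega>. 1 + tanh (\<mu> * U r \<omega>)))" by simp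
  moreover have "(\<integral>\<omega>. \<xi> \<omega> \<partial>D f) = (\<integral>\<omega>. f \<omega> *\<^sub>R \<xi> \<omega> \<partial>M)"
    if [measurable]: "f \<in> borel_measurable M" and "\<And>\<omega>. \<omega> \<in> space M \<Longrightarrow> 0 \<le> f \<omega>" for f
    unfolding D_def using that by (subst integral_distr) (auto intro!: integral_density)
  moreover have "0 \<le> 1 + \<epsilon> \<omega>" if "\<omega> \<in> space M" for \<omega> using sign[OF that] by auto
  moreover have "0 \<le> 1 + tanh (\<mu> * U r \<omega>)" for \<omega> using abs_tanh_le_1[of "\<mu> * U r \<omega>"] by linarith
  ultimately have eq: "(\<integral>\<omega>. (1 + \<epsilon> \<omega>) *\<^sub>R \<xi> \<omega> \<partial>M) = (\<integral>\<omega>. (1 + tanh (\<mu> * U r \<omega>)) *\<^sub>R \<xi> \<omega> \<partial>M)"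
    by (simp del: scaleR_add_left)
  have int: "integrable M (\<lambda>\<omega>. f \<omega> *\<^sub>R \<xi> \<omega>)"
    if [measurable]: "f \<in> borel_measurable M" and "\<And>\<omega>. \<omega> \<in> space M \<Longrightarrow> \<bar>f \<omega>\<bar> \<le> 2" for f
    using that bd by (intro integrable_const_bound[of _ "2 * K"]) (auto intro!: mult_mono)
  have "(\<integral>\<omega>. \<xi> \<omega> * of_real (\<epsilon> \<omega> - tanh (\<mu> * U r \<omega>)) \<partial>M) =
    (\<integral>\<omega>. (1 + \<epsilon> \<omega>) *\<^sub>R \<xi> \<omega> - (1 + tanh (\<mu> * U r \<omega>)) *\<^sub>R \<xi> \<omega> \<partial>M)"
    by (intro Bochner_Integration.integral_cong refl) (auto simp: scaleR_conv_of_real algebra_simps)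
  also have "\<dots> = 0"
  proof (subst Bochner_Integration.integral_diff)
    show "integrable M (\<lambda>\<omega>. (1 + \<epsilon> \<omega>) *\<^sub>R \<xi> \<omega>)" using sign by (intro int) force+
    show "integrable M (\<lambda>\<omega>. (1 + tanh (\<mu> * U r \<omega>)) *\<^sub>R \<xi> \<omega>)"
    proof (rule int)
      show "\<bar>1 + tanh (\<mu> * U r \<omega>)\<bar> \<le> 2" for \<omega> using abs_tanh_le_1[of "\<mu> * U r \<omega>"] by linarith
    qed simp
  qed (simp only: eq, simp)
  finally show ?thesis .
qed

text \<open>Once the sign is known, \<open>U\<close> is \<open>X\<close> or \<open>- X\<close>, both
  functions of \<open>B\<close>. An event of the past of \<open>U\<close> is thus an event of the
  past of \<open>B\<close> on each half of the space, a property preserved by the sigma-algebra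
  operations.\<close>

lemma sets_natural_filtration_U:
  assumes "A \<in> sets (natural_filtration M U r)"
  shows "\<exists>A\<^sub>1\<in>sets (natural_filtration M B r). \<exists>A\<^sub>2\<in>sets (natural_filtration M B r).
    \<forall>\<omega>\<in>space M. \<omega> \<in> A \<longleftrightarrow> (if \<epsilon> \<omega> = 1 then \<omega> \<in> A\<^sub>1 else \<omega> \<in> A\<^sub>2)"
  using assms unfolding sets_natural_filtration[of M U r]
proof induction
  case (Basic a)
  then obtain u C where u: "0 \<le> u" "u \<le> r" "C \<in> sets borel" and a: "a = U u -` C \<inter> space M" by blast
  let ?F = "natural_filtration M B r"
  have [measurable]: "B u \<in> borel_measurable ?F"
    by (rule measurable_natural_filtration) (use u in auto)
  have X: "(\<lambda>\<omega>. X u \<omega>) \<in> borel_measurable ?F"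
    by (intro borel_measurable_add borel_measurable_const) fact
  have "(\<lambda>\<omega>. X u \<omega>) -` C \<inter> space ?F \<in> sets ?F" "(\<lambda>\<omega>. - X u \<omega>) -` C \<inter> space ?F \<in> sets ?F"
    by (rule measurable_sets[OF X u(3)], rule measurable_sets[OF borel_measurable_uminus[OF X] u(3)])
  moreover have "\<omega> \<in> a \<longleftrightarrow> (if \<epsilon> \<omega> = 1 then \<omega> \<in> (\<lambda>\<omega>. X u \<omega>) -` C \<inter> space ?F
      else \<omega> \<in> (\<lambda>\<omega>. - X u \<omega>) -` C \<inter> space ?F)" if "\<omega> \<in> space M" for \<omega>
    using sign[OF that] that by (auto simp: a)
  ultimately show ?case by blast
next
  case Empty
  show ?case by (rule bexI[of _ "{}"], rule bexI[of _ "{}"]) auto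
next
  case (Compl a)
  then obtain A\<^sub>1 A\<^sub>2 where "A\<^sub>1 \<in> sets (natural_filtration M B r)" "A\<^sub>2 \<in> sets (natural_filtration M B r)"
    "\<forall>\<omega>\<in>space M. \<omega> \<in> a \<longleftrightarrow> (if \<epsilon> \<omega> = 1 then \<omega> \<in> A\<^sub>1 else \<omega> \<in> A\<^sub>2)" by blast
  then have "space M - A\<^sub>1 \<in> sets (natural_filtration M B r)"
    "space M - A\<^sub>2 \<in> sets (natural_filtration M B r)"
    "\<forall>\<omega>\<in>space M. \<omega> \<in> space M - a \<longleftrightarrow>
      (if \<epsilon> \<omega> = 1 then \<omega> \<in> space M - A\<^sub>1 else \<omega> \<in> space M - A\<^sub>2)"
    using sets.compl_sets[of _ "natural_filtration M B r"] by auto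
  then show ?case by blast
next
  case (Union a)
  have "\<forall>i. \<exists>A\<^sub>1\<in>sets (natural_filtration M B r). \<exists>A\<^sub>2\<in>sets (natural_filtration M B r).
    \<forall>\<omega>\<in>space M. \<omega> \<in> a i \<longleftrightarrow> (if \<epsilon> \<omega> = 1 then \<omega> \<in> A\<^sub>1 else \<omega> \<in> A\<^sub>2)"
    using Union.IH by blast
  then obtain A\<^sub>1 where A1: "\<And>i. A\<^sub>1 i \<in> sets (natural_filtration M B r)"
    and "\<forall>i. \<exists>A\<^sub>2\<in>sets (natural_filtration M B r).
    \<forall>\<omega>\<in>space M. \<omega> \<in> a i \<longleftrightarrow> (if \<epsilon> \<omega> = 1 then \<omega> \<in> A\<^sub>1 i else \<omega> \<in> A\<^sub>2)"
    unfolding Bex_def by (auto dest!: choice)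
  then obtain A\<^sub>2 where A2: "\<And>i. A\<^sub>2 i \<in> sets (natural_filtration M B r)"
    and "\<forall>i. \<forall>\<omega>\<in>space M. \<omega> \<in> a i \<longleftrightarrow> (if \<epsilon> \<omega> = 1 then \<omega> \<in> A\<^sub>1 i else \<omega> \<in> A\<^sub>2 i)"
    unfolding Bex_def by (auto dest!: choice)
  then have "\<forall>\<omega>\<in>space M. \<omega> \<in> (\<Union>i. a i) \<longleftrightarrow>
      (if \<epsilon> \<omega> = 1 then \<omega> \<in> (\<Union>i. A\<^sub>1 i) else \<omega> \<in> (\<Union>i. A\<^sub>2 i))"
    by auto
  moreover have "(\<Union>i. A\<^sub>1 i) \<in> sets (natural_filtration M B r)" "(\<Union>i. A\<^sub>2 i) \<in> sets (natural_filtration M B r)"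
    using A1 A2 by auto
  ultimately show ?case by blast
qed

section \<open>Signed Brownian increments given the past of \<open>U\<close>\<close>

lemma integrable_bounded_complex:
  fixes f :: "'a \<Rightarrow> complex"
  shows "f \<in> borel_measurable M \<Longrightarrow> (\<And>\<omega>. \<omega> \<in> space M \<Longrightarrow> cmod (f \<omega>) \<le> K) \<Longrightarrow> integrable M f"
  by (rule integrable_const_bound[of _ K]) auto

text \<open>The past of \<open>U\<close> reveals information about the sign, yet the signed
  increment remains independent of it: on either half the increment of \<open>B\<close> is
  independent of the corresponding event, and the normal characteristic function is even in
  \<open>l\<close>.\<close>

lemma char_signed_increment:
  assumes st: "0 \<le> s" "s < t" and A: "A \<in> sets (natural_filtration M U s)"
  shows "(\<integral>\<omega>. indicator A \<omega> * iexp (l * (\<epsilon> \<omega> * (B t \<omega> - B s \<omega>))) \<partial>M) =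
    prob A * exp (- (l * sqrt (t - s))\<^sup>2 / 2)"
proof -
  obtain A\<^sub>1 A\<^sub>2 where A12: "A\<^sub>1 \<in> sets (natural_filtration M B s)" "A\<^sub>2 \<in> sets (natural_filtration M B s)"
    and A_eq: "\<And>\<omega>. \<omega> \<in> space M \<Longrightarrow> \<omega> \<in> A \<longleftrightarrow> (if \<epsilon> \<omega> = 1 then \<omega> \<in> A\<^sub>1 else \<omega> \<in> A\<^sub>2)"
    using sets_natural_filtration_U[OF A] by blast
  let ?R = "\<lambda>\<omega>. B t \<omega> - B s \<omega>"
  have A'[measurable]: "A \<in> events" using A subalgebra_U[of s] by (auto simp: subalgebra_def)
  \<comment> \<open>The sign separates first, being independent of all of \<open>B\<close> up to
    \<open>t\<close>; then the event \<open>D\<close> separates from the increment at time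
    \<open>s\<close>.\<close>
  have part: "(\<integral>\<omega>. (indicator D \<omega> * iexp (l * ?R \<omega>)) * of_real (indicator E (\<epsilon> \<omega>)) \<partial>M) =
    of_real (prob D * exp (- (l * sqrt (t - s))\<^sup>2 / 2)) * (\<integral>\<omega>. of_real (indicator E (\<epsilon> \<omega>)) \<partial>M)"
    if D: "D \<in> sets (natural_filtration M B s)" and [measurable]: "E \<in> sets borel" for D E l
  proof -
    have Dt[measurable]: "D \<in> sets (natural_filtration M B t)"
      using D natural_filtration_mono[of s t M B] st by auto
    have DM[measurable]: "D \<in> events" using D subalgebra_B[of s] by (auto simp: subalgebra_def)
    have [measurable]: "B t \<in> borel_measurable (natural_filtration M B t)"
      "B s \<in> borel_measurable (natural_filtration M B t)"
      by (rule measurable_natural_filtration; use st in simp)+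
    have "(\<integral>\<omega>. (indicator D \<omega> * iexp (l * ?R \<omega>)) * of_real (indicator E (\<epsilon> \<omega>)) \<partial>M) =
       (\<integral>\<omega>. (indicator D \<omega> * iexp (l * ?R \<omega>)) \<partial>M) * (\<integral>\<omega>. of_real (indicator E (\<epsilon> \<omega>)) \<partial>M)"
      using st by (intro integral_indep_set_mult[OF subalgebra_B[of t] _ sign_indep])
        (auto intro!: integrable_bounded_complex[of _ 1] simp: norm_mult split: split_indicator)
    also have "(\<integral>\<omega>. (indicator D \<omega> * iexp (l * ?R \<omega>)) \<partial>M) =
      (\<integral>\<omega>. indicator D \<omega> \<partial>M) * (\<integral>\<omega>. iexp (l * ?R \<omega>) \<partial>M)"
      using D by (intro integral_indep_set_mult[OF subalgebra_B[of s] _ B_indep[OF st]])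
        (auto intro!: integrable_bounded_complex[of _ 1] simp: norm_mult split: split_indicator)
    also have "(\<integral>\<omega>. iexp (l * ?R \<omega>) \<partial>M) = exp (- (l * sqrt (t - s))\<^sup>2 / 2)"
      using st by (intro char_centered_normal[OF _ B_normal[OF st]]) auto
    also have "(\<integral>\<omega>. (indicator D \<omega> :: complex) \<partial>M) = prob D"
    proof -
      have "(\<integral>\<omega>. (indicator D \<omega> :: complex) \<partial>M) = (\<integral>\<omega>. of_real (indicator D \<omega>) \<partial>M)"
        by (intro Bochner_Integration.integral_cong) (auto split: split_indicator)
      then show ?thesis by (simp only: integral_complex_of_real) simp
    qed
    finally show ?thesis by simp
  qed
  define p where "p E = (\<integral>\<omega>. complex_of_real (indicator E (\<epsilon> \<omega>)) \<partial>M)" for E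
  \<comment> \<open>The constant \<open>q\<close> does not depend on \<open>l\<close>, so putting
    \<open>l = 0\<close> in \<open>main\<close> identifies it as \<open>prob A\<close>.\<close>
  define q where "q = complex_of_real (prob A\<^sub>1) * p {1} + complex_of_real (prob A\<^sub>2) * p {-1}"
  have main: "(\<integral>\<omega>. indicator A \<omega> * iexp (l * (\<epsilon> \<omega> * ?R \<omega>)) \<partial>M) = q * exp (- (l * sqrt (t - s))\<^sup>2 / 2)" for l
  proof -
    have [measurable]: "A\<^sub>1 \<in> events" "A\<^sub>2 \<in> events" using A12 subalgebra_B[of s] by (auto simp: subalgebra_def)
    have "(\<integral>\<omega>. indicator A \<omega> * iexp (l * (\<epsilon> \<omega> * ?R \<omega>)) \<partial>M) =
      (\<integral>\<omega>. (indicator A\<^sub>1 \<omega> * iexp (l * ?R \<omega>)) * of_real (indicator {1} (\<epsilon> \<omega>)) +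
        (indicator A\<^sub>2 \<omega> * iexp (- l * ?R \<omega>)) * of_real (indicator {-1} (\<epsilon> \<omega>)) \<partial>M)"
    proof (intro Bochner_Integration.integral_cong refl)
      fix \<omega> assume "\<omega> \<in> space M"
      then have "- l * ?R \<omega> = l * (- 1 * ?R \<omega>)" and "\<epsilon> \<omega> = 1 \<or> \<epsilon> \<omega> = -1"
        using sign by (auto simp: algebra_simps)
      with \<open>\<omega> \<in> space M\<close> show "indicator A \<omega> * iexp (l * (\<epsilon> \<omega> * ?R \<omega>)) =
         (indicator A\<^sub>1 \<omega> * iexp (l * ?R \<omega>)) * of_real (indicator {1} (\<epsilon> \<omega>)) +
        (indicator A\<^sub>2 \<omega> * iexp (- l * ?R \<omega>)) * of_real (indicator {-1} (\<epsilon> \<omega>))"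
        using A_eq[of \<omega>] by (elim disjE; simp only:) (simp_all add: indicator_def)
    qed
    also have "\<dots> = of_real (prob A\<^sub>1 * exp (- (l * sqrt (t - s))\<^sup>2 / 2)) * p {1} +
       of_real (prob A\<^sub>2 * exp (- (- l * sqrt (t - s))\<^sup>2 / 2)) * p {-1}"
    proof -
      have "{1} \<in> sets (borel :: real measure)" "{-1} \<in> sets (borel :: real measure)" by auto
      note p12 = part[OF A12(1) this(1), of l] part[OF A12(2) this(2), of "- l"]
      show ?thesis
        unfolding p_def p12[symmetric]
        by (intro Bochner_Integration.integral_add integrable_bounded_complex[of _ 1])
          (auto simp: norm_mult split: split_indicator)
    qed
    finally show ?thesis by (simp add: q_def algebra_simps)
  qed
  have "(\<integral>\<omega>. (indicator A \<omega> :: complex) \<partial>M) = (\<integral>\<omega>. of_real (indicator A \<omega>) \<partial>M)"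
    by (intro Bochner_Integration.integral_cong) (auto split: split_indicator)
  also have "\<dots> = prob A" by (simp only: integral_complex_of_real) simp
  finally have "q = prob A" using main[of 0] by simp
  then show ?thesis using main[of l] by simp
qed

end

section \<open>The innovation process\<close>

text \<open>Rounding time down to the grid of mesh \<open>1 / Suc n\<close> leaves countably many
  values, so each approximation is jointly measurable; continuity of the paths passes this to the
  limit.\<close>

lemma measurable_continuous_process:
  fixes Z :: "real \<Rightarrow> 'a \<Rightarrow> real"
  assumes meas: "\<And>v. Z v \<in> borel_measurable F"
    and cont: "\<And>\<omega>. \<omega> \<in> space F \<Longrightarrow> continuous_on UNIV (\<lambda>v. Z v \<omega>)"
  shows "(\<lambda>p. Z (snd p) (fst p)) \<in> borel_measurable (F \<Otimes>\<^sub>M borel)"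
proof (rule borel_measurable_LIMSEQ_real)
  define q where "q n v = real_of_int \<lfloor>v * real (Suc n)\<rfloor> / real (Suc n)" for n v
  have q: "(\<lambda>n. q n v) \<longlonglongrightarrow> v" for v
  proof (rule LIM_zero_cancel, rule Lim_null_comparison[OF _ LIMSEQ_inverse_real_of_nat])
    have "norm (q n v - v) \<le> inverse (real (Suc n))" for n
    proof -
      have "q n v - v = (real_of_int \<lfloor>v * real (Suc n)\<rfloor> - v * real (Suc n)) / real (Suc n)"
        by (simp add: q_def diff_divide_distrib del: of_nat_Suc)
      moreover have "\<bar>real_of_int \<lfloor>v * real (Suc n)\<rfloor> - v * real (Suc n)\<bar> \<le> 1" by linarith
      ultimately show ?thesis
        by (simp add: divide_right_mono inverse_eq_divide del: of_nat_Suc)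
    qed
    then show "\<forall>\<^sub>F n in sequentially. norm (q n v - v) \<le> inverse (real (Suc n))" by simp
  qed
  show "(\<lambda>n. Z (q n (snd p)) (fst p)) \<longlonglongrightarrow> Z (snd p) (fst p)" if "p \<in> space (F \<Otimes>\<^sub>M borel)" for p
  proof (rule isCont_tendsto_compose[OF _ q])
    have "fst p \<in> space F" using that by (auto simp: space_pair_measure)
    from cont[OF this] show "isCont (\<lambda>v. Z v (fst p)) (snd p)"
      by (simp add: continuous_on_eq_continuous_at)
  qed
  show "(\<lambda>p. Z (q n (snd p)) (fst p)) \<in> borel_measurable (F \<Otimes>\<^sub>M borel)" for n
  proof -
    have "(\<lambda>p. (\<lambda>i::int. \<lambda>p. Z (real_of_int i / real (Suc n)) (fst p)) \<lfloor>snd p * real (Suc n)\<rfloor> p)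
        \<in> borel_measurable (F \<Otimes>\<^sub>M (borel :: real measure))"
    proof (rule measurable_compose_countable[where f="\<lambda>(i::int) p. Z (real_of_int i / real (Suc n)) (fst p)"
          and g="\<lambda>p. \<lfloor>snd p * real (Suc n)\<rfloor>"])
      show "(\<lambda>p. Z (real_of_int i / real (Suc n)) (fst p)) \<in> borel_measurable (F \<Otimes>\<^sub>M (borel :: real measure))" for i
        by (rule measurable_compose[OF measurable_fst meas])
    qed measurable
    then show ?thesis by (simp add: q_def)
  qed
qed

text \<open>Cutting the interval into \<open>Suc n\<close> equal steps of length h bounds the total
  change by \<open>K * ((t - s) * (h + sqrt h))\<close>, which tends to 0. An increment of order
  above 1 plays the part of a vanishing derivative.\<close>

lemma constant_of_small_increments:
  fixes G :: "real \<Rightarrow> 'b::real_normed_vector"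
  assumes st: "s \<le> t"
    and G: "\<And>r h. s \<le> r \<Longrightarrow> 0 < h \<Longrightarrow> r + h \<le> t \<Longrightarrow> norm (G (r + h) - G r) \<le> K * (h * (h + sqrt h))"
  shows "G t = G s"
proof (cases "s = t")
  case False
  have bound: "norm (G t - G s) \<le> K * ((t - s) * ((t - s) / Suc n + sqrt ((t - s) / Suc n)))" for n
  proof -
    define h where "h = (t - s) / Suc n"
    have h: "h > 0" "Suc n * h = t - s" using st False by (auto simp: h_def)
    have "norm (G (s + real k * h) - G s) \<le> real k * (K * (h * (h + sqrt h)))" if "k \<le> Suc n" for k
      using that
    proof (induction k)
      case (Suc k)
      have "real (Suc k) * h \<le> real (Suc n) * h" using Suc.prems h(1) by (intro mult_right_mono) auto
      then have le: "(s + real k * h) + h \<le> t" using h(2) by (simp add: algebra_simps)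
      have eq: "s + real (Suc k) * h = (s + real k * h) + h" by (simp add: algebra_simps)
      have "norm (G (s + real (Suc k) * h) - G s) \<le>
        norm (G ((s + real k * h) + h) - G (s + real k * h)) + norm (G (s + real k * h) - G s)"
        unfolding eq
        using norm_triangle_ineq[of "G ((s + real k * h) + h) - G (s + real k * h)" "G (s + real k * h) - G s"]
        by simp
      also have "\<dots> \<le> K * (h * (h + sqrt h)) + real k * (K * (h * (h + sqrt h)))"
        using Suc h le by (intro add_mono G) auto
      finally show ?case by (simp add: algebra_simps)
    qed simp
    from this[of "Suc n"] have "norm (G t - G s) \<le> real (Suc n) * (K * (h * (h + sqrt h)))"
      unfolding h(2) by simp
    also have "\<dots> = K * ((real (Suc n) * h) * (h + sqrt h))" by simp
    finally show ?thesis unfolding h(2) unfolding h_def .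
  qed
  have "(\<lambda>n. (t - s) / Suc n) \<longlonglongrightarrow> 0"
    using LIMSEQ_Suc[OF lim_const_over_n[of "t - s"]] by simp
  then have "(\<lambda>n. K * ((t - s) * ((t - s) / Suc n + sqrt ((t - s) / Suc n)))) \<longlonglongrightarrow> K * ((t - s) * (0 + sqrt 0))"
    by (intro tendsto_intros)
  from LIMSEQ_le_const[OF this] bound have "norm (G t - G s) \<le> K * ((t - s) * (0 + sqrt 0))" by blast
  then show ?thesis by simp
qed simp

text \<open>A first-order expansion in \<open>d\<close> whose linear coefficient
  \<open>iexp (l * a)\<close> is replaced by 1, at the price of the mixed term. The linear term is
  then free of \<open>a\<close>, so the filter identity applies to it even though \<open>a\<close>
  and \<open>d\<close> will be dependent.\<close>

lemma iexp_perturbation: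
  "cmod (iexp (l * (a + d)) - (iexp (l * a) + \<i> * (l * d))) \<le> l\<^sup>2 * d\<^sup>2 / 2 + l\<^sup>2 * \<bar>a\<bar> * \<bar>d\<bar>"
proof -
  have "iexp (l * (a + d)) = iexp (l * a) * iexp (l * d)"
    by (simp add: exp_add[symmetric] algebra_simps)
  then have "iexp (l * (a + d)) - (iexp (l * a) + \<i> * (l * d)) =
    iexp (l * a) * (iexp (l * d) - (1 + \<i> * (l * d))) + (iexp (l * a) - 1) * (\<i> * (l * d))"
    by (simp add: algebra_simps)
  also have "cmod \<dots> \<le> cmod (iexp (l * a) * (iexp (l * d) - (1 + \<i> * (l * d)))) + cmod ((iexp (l * a) - 1) * (\<i> * (l * d)))"
    by (rule norm_triangle_ineq)
  also have "\<dots> = cmod (iexp (l * d) - (1 + \<i> * (l * d))) + cmod (iexp (l * a) - 1) * \<bar>l * d\<bar>"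
    by (simp only: norm_mult cmod_iexp norm_of_real norm_ii mult_1)
  also have "\<dots> \<le> \<bar>l * d\<bar>\<^sup>2 / 2 + \<bar>l * a\<bar> * \<bar>l * d\<bar>"
    using iexp_approx1[of "l * d" 1] iexp_approx1[of "l * a" 0]
    by (intro add_mono mult_right_mono) (simp_all add: numeral_2_eq_2)
  also have "\<dots> = l\<^sup>2 * d\<^sup>2 / 2 + l\<^sup>2 * \<bar>a\<bar> * \<bar>d\<bar>"
  proof -
    have "\<bar>l * a\<bar> * \<bar>l * d\<bar> = (\<bar>l\<bar> * \<bar>l\<bar>) * \<bar>a\<bar> * \<bar>d\<bar>" by (simp add: abs_mult mult_ac)
    then show ?thesis by (simp only: abs_mult_self_eq power2_abs power_mult_distrib power2_eq_square[symmetric])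
  qed
  finally show ?thesis .
qed

section \<open>Adaptedness and path regularity of the innovation\<close>

context brownian_with_sign
begin

text \<open>The time integral of the filter without the factor \<open>\<mu>\<close>; the drift rate
  \<open>m\<close> of \<open>S\<close> is a different process.\<close>

definition drift :: "real \<Rightarrow> 'a \<Rightarrow> real" where
  "drift t \<omega> = (LBINT v:{0..t}. tanh (\<mu> * U v \<omega>))"

definition innovation :: "real \<Rightarrow> 'a \<Rightarrow> real" where
  "innovation t \<omega> = U t \<omega> - \<mu> * drift t \<omega>"

lemma U_cont: "\<omega> \<in> space M \<Longrightarrow> continuous_on UNIV (\<lambda>v. U v \<omega>)"
  using B_cont by (intro continuous_intros)

lemma tanh_U_cont: "\<omega> \<in> space M \<Longrightarrow> continuous_on A (\<lambda>v. tanh (\<mu> * U v \<omega>))"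
  by (rule continuous_on_subset[OF _ subset_UNIV]) (intro continuous_intros B_cont; simp)

lemma tanh_U_set_integrable:
  "\<omega> \<in> space M \<Longrightarrow> set_integrable lborel {a..b} (\<lambda>v. tanh (\<mu> * U v \<omega>))"
  "\<omega> \<in> space M \<Longrightarrow> set_integrable lborel {a<..b} (\<lambda>v. tanh (\<mu> * U v \<omega>))"
proof -
  assume \<omega>: "\<omega> \<in> space M"
  show 1: "set_integrable lborel {a..b} (\<lambda>v. tanh (\<mu> * U v \<omega>))"
    by (rule borel_integrable_atLeastAtMost'[OF tanh_U_cont[OF \<omega>]])
  show "set_integrable lborel {a<..b} (\<lambda>v. tanh (\<mu> * U v \<omega>))"
    by (rule set_integrable_subset[OF 1]) auto
qed

lemma drift_diff:
  assumes \<omega>: "\<omega> \<in> space M" and "0 \<le> r" "r \<le> t"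
  shows "drift t \<omega> - drift r \<omega> = (LBINT v:{r<..t}. tanh (\<mu> * U v \<omega>))"
proof -
  have "{0..t} = {0..r} \<union> {r<..t}" "{0..r} \<inter> {r<..t} = {}" using assms by auto
  then show ?thesis
    unfolding drift_def
    using set_integral_Un[OF _ tanh_U_set_integrable(1)[OF \<omega>, of 0 r] tanh_U_set_integrable(2)[OF \<omega>, of r t]]
    by auto
qed

lemma drift_lipschitz:
  assumes \<omega>: "\<omega> \<in> space M"
  shows "1-lipschitz_on {0..} (\<lambda>t. drift t \<omega>)"
proof -
  have le: "\<bar>drift t \<omega> - drift r \<omega>\<bar> \<le> t - r" if "0 \<le> r" "r \<le> t" for r t
  proof -
    have "\<bar>drift t \<omega> - drift r \<omega>\<bar> \<le> (LBINT v:{r<..t}. 1)"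
      unfolding drift_diff[OF \<omega> that] set_lebesgue_integral_def
      using tanh_U_set_integrable(2)[OF \<omega>, of r t] abs_tanh_le_1 that
      by (intro integral_abs_bound_integral) (auto simp: set_integrable_def abs_mult split: split_indicator)
    then show ?thesis using that by (simp add: set_lebesgue_integral_def)
  qed
  show ?thesis
  proof (rule lipschitz_onI)
    fix x y :: real assume "x \<in> {0..}" "y \<in> {0..}"
    then show "dist (drift x \<omega>) (drift y \<omega>) \<le> 1 * dist x y"
      using le[of x y] le[of y x] by (cases "x \<le> y") (auto simp: dist_real_def abs_minus_commute)
  qed simp
qed

lemma innovation_cont: "\<omega> \<in> space M \<Longrightarrow> continuous_on {0..} (\<lambda>t. innovation t \<omega>)"
  unfolding innovation_def
  by (intro continuous_intros lipschitz_on_continuous_on[OF drift_lipschitz]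
      continuous_on_subset[OF B_cont]) auto

text \<open>Clamping time to the interval from 0 to \<open>t\<close> makes the process defined at
  every real time, still continuous, and never later than \<open>t\<close>, so joint measurability
  holds relative to the past at \<open>t\<close>.\<close>

lemma measurable_U_clamped:
  assumes "0 \<le> t"
  shows "(\<lambda>p. U (max 0 (min (snd p) t)) (fst p)) \<in> borel_measurable (natural_filtration M U t \<Otimes>\<^sub>M borel)"
proof (rule measurable_continuous_process[where Z="\<lambda>v. U (max 0 (min v t))"])
  fix \<omega> assume "\<omega> \<in> space (natural_filtration M U t)"
  then have "continuous_on UNIV (\<lambda>v. U v \<omega>)" by (intro U_cont) simp
  then show "continuous_on UNIV (\<lambda>v. U (max 0 (min v t)) \<omega>)"
    by (rule continuous_on_compose2) (intro continuous_intros, auto)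
qed (use assms in \<open>auto intro!: measurable_natural_filtration\<close>)

lemma drift_measurable:
  assumes "0 \<le> u" "u \<le> t"
  shows "drift u \<in> borel_measurable (natural_filtration M U t)"
proof -
  let ?F = "natural_filtration M U t"
  have Um: "(\<lambda>p. U (max 0 (min (snd p) t)) (fst p)) \<in> borel_measurable (?F \<Otimes>\<^sub>M borel)"
    using assms by (intro measurable_U_clamped) auto
  \<comment> \<open>The clamp is the identity on \<open>{0..u}\<close>, so the integral does not
    change.\<close>
  have "drift u \<omega> = (LBINT v. indicator {0..u} v *\<^sub>R tanh (\<mu> * U (max 0 (min v t)) \<omega>))" for \<omega>
    unfolding drift_def set_lebesgue_integral_def using assms
    by (intro Bochner_Integration.integral_cong) (auto split: split_indicator)
  moreover have "(\<lambda>\<omega>. LBINT v. indicator {0..u} v *\<^sub>R tanh (\<mu> * U (max 0 (min v t)) \<omega>)) \<in> borel_measurable ?F"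
  proof (rule lborel.borel_measurable_lebesgue_integral)
    have "(\<lambda>p. indicator {0..u} (snd p) *\<^sub>R tanh (\<mu> * U (max 0 (min (snd p) t)) (fst p))) \<in> borel_measurable (?F \<Otimes>\<^sub>M borel)"
      by (intro borel_measurable_scaleR measurable_compose[OF measurable_snd borel_measurable_indicator]
          measurable_compose[OF Um, of "\<lambda>x. tanh (\<mu> * x)" borel]) auto
    then show "(\<lambda>(\<omega>, v). indicator {0..u} v *\<^sub>R tanh (\<mu> * U (max 0 (min v t)) \<omega>)) \<in> borel_measurable (?F \<Otimes>\<^sub>M lborel)"
      by (simp add: split_beta' cong: measurable_cong_sets)
  qed
  ultimately show ?thesis by (simp cong: measurable_cong)
qed

lemma innovation_measurable:
  assumes "0 \<le> u" "u \<le> t"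
  shows "innovation u \<in> borel_measurable (natural_filtration M U t)"
  unfolding innovation_def
  by (intro borel_measurable_diff borel_measurable_times borel_measurable_const
      drift_measurable[OF assms] measurable_natural_filtration[OF assms, of U])

lemma innovation_measurable_M: "0 \<le> u \<Longrightarrow> innovation u \<in> borel_measurable M"
  by (rule measurable_from_subalg[OF subalgebra_U innovation_measurable]) auto

text \<open>The accumulated filtering error: by \<open>innovation_diff\<close>, what remains of an
  innovation increment after the signed Brownian increment is removed.\<close>

definition residual :: "real \<Rightarrow> real \<Rightarrow> 'a \<Rightarrow> real" where
  "residual r t \<omega> = (LBINT v:{r<..t}. \<mu> * (\<epsilon> \<omega> - tanh (\<mu> * U v \<omega>)))"

lemma residual_bound:
  assumes \<omega>: "\<omega> \<in> space M" and "r \<le> t"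
  shows "\<bar>residual r t \<omega>\<bar> \<le> 2 * \<bar>\<mu>\<bar> * (t - r)"
proof -
  have b: "\<bar>\<mu> * (\<epsilon> \<omega> - tanh (\<mu> * U v \<omega>))\<bar> \<le> 2 * \<bar>\<mu>\<bar>" for v
  proof -
    have "\<bar>\<epsilon> \<omega> - tanh (\<mu> * U v \<omega>)\<bar> \<le> 2"
      using abs_tanh_le_1[of "\<mu> * U v \<omega>"] sign[OF \<omega>] by linarith
    then show ?thesis unfolding abs_mult by (subst mult.commute[of 2]) (rule mult_left_mono, auto)
  qed
  have "set_integrable lborel {r<..t} (\<lambda>v. \<mu> * (\<epsilon> \<omega> - tanh (\<mu> * U v \<omega>)))"
    using tanh_U_set_integrable(2)[OF \<omega>, of r t] \<open>r \<le> t\<close>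
    by (intro set_integrable_mult_right set_integral_diff) (auto simp: set_integrable_def)
  then have "\<bar>residual r t \<omega>\<bar> \<le> (LBINT v:{r<..t}. 2 * \<bar>\<mu>\<bar>)"
    unfolding residual_def set_lebesgue_integral_def
  proof (intro integral_abs_bound_integral)
    show "integrable lborel (\<lambda>v. indicator {r<..t} v *\<^sub>R (2 * \<bar>\<mu>\<bar>))"
      using \<open>r \<le> t\<close> by (intro integrable_scaleR_left integrable_real_indicator) auto
  qed (use b in \<open>auto simp: set_integrable_def split: split_indicator\<close>)
  then show ?thesis using assms by (simp add: set_lebesgue_integral_def algebra_simps)
qed

lemma innovation_diff:
  assumes \<omega>: "\<omega> \<in> space M" and rt: "0 \<le> r" "r \<le> t"
  shows "innovation t \<omega> - innovation r \<omega> = \<epsilon> \<omega> * (B t \<omega> - B r \<omega>) + residual r t \<omega>"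
proof -
  have "residual r t \<omega> = \<mu> * ((LBINT v:{r<..t}. \<epsilon> \<omega>) - (LBINT v:{r<..t}. tanh (\<mu> * U v \<omega>)))"
    unfolding residual_def using tanh_U_set_integrable(2)[OF \<omega>, of r t]
      rt(2)
    by (subst set_integral_diff(2)[symmetric]) (auto simp: set_integrable_def)
  also have "(LBINT v:{r<..t}. \<epsilon> \<omega>) = (t - r) * \<epsilon> \<omega>"
    using rt by (simp add: set_lebesgue_integral_def)
  finally show ?thesis
    unfolding innovation_def drift_diff[OF \<omega> rt, symmetric] by (simp add: algebra_simps)
qed

text \<open>A weight known at \<open>r\<close> is also known at every later \<open>v\<close>, so the
  filter identity at \<open>v\<close> annihilates each time slice; Fubini then integrates over
  \<open>v\<close>.\<close>

lemma integral_residual: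
  fixes \<xi> :: "'a \<Rightarrow> complex"
  assumes rt: "0 \<le> r" "r \<le> t" and \<xi>: "\<xi> \<in> borel_measurable (natural_filtration M U r)"
    and bd: "\<And>\<omega>. cmod (\<xi> \<omega>) \<le> K"
  shows "(\<integral>\<omega>. \<xi> \<omega> * of_real (residual r t \<omega>) \<partial>M) = 0"
proof -
  interpret P: pair_sigma_finite M lborel ..
  define f where "f \<omega> v = indicator {r<..t} v *\<^sub>R (\<xi> \<omega> * of_real (\<mu> * (\<epsilon> \<omega> - tanh (\<mu> * U v \<omega>))))" for \<omega> v
  have \<xi>M[measurable]: "\<xi> \<in> borel_measurable M" by (rule measurable_from_subalg[OF subalgebra_U \<xi>])
  have [measurable]: "(\<lambda>p. U (snd p) (fst p)) \<in> borel_measurable (M \<Otimes>\<^sub>M borel)"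
    by (rule measurable_continuous_process[where Z=U]) (use U_cont in auto)
  have K: "0 \<le> K" using bd[of undefined] norm_ge_zero order_trans by blast
  have int: "integrable (M \<Otimes>\<^sub>M lborel) (case_prod f)"
  proof (rule integrableI_bounded_set[of "space M \<times> {r<..t}" _ _ "K * (\<bar>\<mu>\<bar> * 2)"])
    show "case_prod f \<in> borel_measurable (M \<Otimes>\<^sub>M lborel)"
      unfolding f_def split_beta' by measurable
    have "emeasure (M \<Otimes>\<^sub>M lborel) (space M \<times> {r<..t}) = emeasure M (space M) * emeasure lborel {r<..t}"
      by (intro lborel.emeasure_pair_measure_Times) auto
    then show "emeasure (M \<Otimes>\<^sub>M lborel) (space M \<times> {r<..t}) < \<infinity>"
      using rt by (simp add: emeasure_space_1)
    have "cmod (f \<omega> v) \<le> K * (\<bar>\<mu>\<bar> * 2)" if \<omega>: "\<omega> \<in> space M" for \<omega> v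
    proof -
      have "\<bar>\<epsilon> \<omega> - tanh (\<mu> * U v \<omega>)\<bar> \<le> 2"
        using abs_tanh_le_1[of "\<mu> * U v \<omega>"] sign[OF \<omega>] by linarith
      then have "cmod (\<xi> \<omega> * of_real (\<mu> * (\<epsilon> \<omega> - tanh (\<mu> * U v \<omega>)))) \<le> K * (\<bar>\<mu>\<bar> * 2)"
        using bd[of \<omega>] K unfolding norm_mult norm_of_real abs_mult by (intro mult_mono) auto
      then show ?thesis using K by (auto simp: f_def split: split_indicator)
    qed
    then show "AE x in M \<Otimes>\<^sub>M lborel. x \<in> space M \<times> {r<..t} \<longrightarrow> norm (case_prod f x) \<le> K * (\<bar>\<mu>\<bar> * 2)"
      by (intro AE_I2) auto
    show "AE x in M \<Otimes>\<^sub>M lborel. x \<notin> space M \<times> {r<..t} \<longrightarrow> case_prod f x = 0"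
      by (intro AE_I2) (auto simp: f_def space_pair_measure indicator_def)
  qed (use sets.top in auto)
  have inner: "(\<integral>\<omega>. f \<omega> v \<partial>M) = 0" for v
  proof (cases "v \<in> {r<..t}")
    case True
    have "(\<integral>\<omega>. \<xi> \<omega> * of_real (\<epsilon> \<omega> - tanh (\<mu> * U v \<omega>)) \<partial>M) = 0"
      using True rt by (intro filter_identity[OF _ _ bd] measurable_from_subalg[OF subalgebra_natural_filtration_mono \<xi>]) auto
    then have "(\<integral>\<omega>. of_real \<mu> * (\<xi> \<omega> * of_real (\<epsilon> \<omega> - tanh (\<mu> * U v \<omega>))) \<partial>M) = 0"
      by (simp del: of_real_diff)
    then show ?thesis using True by (simp add: f_def mult.left_commute del: of_real_diff)
  next
    case False
    then show ?thesis by (simp add: f_def)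
  qed
  have "(\<integral>\<omega>. \<xi> \<omega> * of_real (residual r t \<omega>) \<partial>M) = (\<integral>\<omega>. (\<integral>v. f \<omega> v \<partial>lborel) \<partial>M)"
  proof (intro Bochner_Integration.integral_cong refl)
    fix \<omega>
    have "(\<integral>v. f \<omega> v \<partial>lborel) = (\<integral>v. \<xi> \<omega> * of_real (indicator {r<..t} v *\<^sub>R (\<mu> * (\<epsilon> \<omega> - tanh (\<mu> * U v \<omega>)))) \<partial>lborel)"
      unfolding f_def by (intro Bochner_Integration.integral_cong) (auto split: split_indicator)
    also have "\<dots> = \<xi> \<omega> * of_real (residual r t \<omega>)"
      unfolding residual_def set_lebesgue_integral_def
      by (simp only: integral_mult_right_zero integral_complex_of_real)
    finally show "\<xi> \<omega> * of_real (residual r t \<omega>) = (\<integral>v. f \<omega> v \<partial>lborel)" ..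
  qed
  also have "\<dots> = (\<integral>v. (\<integral>\<omega>. f \<omega> v \<partial>M) \<partial>lborel)"
    by (rule P.Fubini_integral[OF int, symmetric])
  also have "\<dots> = 0" by (simp add: inner)
  finally show ?thesis .
qed

text \<open>The first absolute moment of a centred normal variable is its standard deviation times
  \<open>sqrt (2 / pi)\<close>, and \<open>pi\<close> is at least 2.\<close>

lemma expectation_abs_increment:
  assumes st: "0 \<le> s" "s < t"
  shows "integrable M (\<lambda>\<omega>. \<bar>B t \<omega> - B s \<omega>\<bar>)"
    and "(\<integral>\<omega>. \<bar>B t \<omega> - B s \<omega>\<bar> \<partial>M) \<le> sqrt (t - s)"
proof -
  have \<sigma>: "0 < sqrt (t - s)" using st by simp
  note D = B_normal[OF st]
  have i: "integrable lborel (\<lambda>x. normal_density 0 (sqrt (t - s)) x * \<bar>x\<bar>)"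
    using integrable_normal_moment_abs[OF \<sigma>, of 0 1] by simp
  then show "integrable M (\<lambda>\<omega>. \<bar>B t \<omega> - B s \<omega>\<bar>)"
    by (subst distributed_integrable[OF D, symmetric]) auto
  have "(\<integral>\<omega>. \<bar>B t \<omega> - B s \<omega>\<bar> \<partial>M) = (\<integral>x. normal_density 0 (sqrt (t - s)) x * \<bar>x\<bar> \<partial>lborel)"
    by (subst distributed_integral[OF D, symmetric]) auto
  also have "\<dots> = sqrt (t - s) * sqrt (2 / pi)"
    using integral_normal_moment_abs_odd[OF \<sigma>, of 0 0] by simp
  also have "\<dots> \<le> sqrt (t - s) * 1"
    using pi_ge_two st by (intro mult_left_mono) (auto simp: real_sqrt_le_1_iff)
  finally show "(\<integral>\<omega>. \<bar>B t \<omega> - B s \<omega>\<bar> \<partial>M) \<le> sqrt (t - s)" by simp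
qed

text \<open>
  Over a step of length \<open>h\<close> the increment is an independent Gaussian plus a residual of size \<open>O(h)\<close>
  whose first-order contribution vanishes by the filter identity.
\<close>

lemma char_innovation_step:
  fixes \<xi> :: "'a \<Rightarrow> complex"
  assumes rt: "0 \<le> r" "r < t" and \<xi>: "\<xi> \<in> borel_measurable (natural_filtration M U r)"
    and bd: "\<And>\<omega>. cmod (\<xi> \<omega>) \<le> 1"
  shows "cmod ((\<integral>\<omega>. \<xi> \<omega> * iexp (l * (innovation t \<omega> - innovation r \<omega>)) \<partial>M) -
      (\<integral>\<omega>. \<xi> \<omega> \<partial>M) * exp (- l\<^sup>2 * (t - r) / 2))
    \<le> 2 * l\<^sup>2 * (\<mu>\<^sup>2 + \<bar>\<mu>\<bar>) * ((t - r) * ((t - r) + sqrt (t - r)))"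
proof -
  let ?h = "t - r"
  let ?W = "\<lambda>\<omega>. \<epsilon> \<omega> * (B t \<omega> - B r \<omega>)"
  let ?D = "residual r t"
  let ?Y = "\<lambda>\<omega>. innovation t \<omega> - innovation r \<omega>"
  have \<xi>M[measurable]: "\<xi> \<in> borel_measurable M" by (rule measurable_from_subalg[OF subalgebra_U \<xi>])
  have YM[measurable]: "?Y \<in> borel_measurable M"
    by (intro borel_measurable_diff innovation_measurable_M) (use rt in auto)
  \<comment> \<open>Measurability of the residual is read off from the decomposition of the
    increment instead of from its defining integral.\<close>
  have "(\<lambda>\<omega>. ?Y \<omega> - ?W \<omega>) \<in> borel_measurable M" by measurable
  then have DM[measurable]: "?D \<in> borel_measurable M"
    by (rule measurable_cong[THEN iffD1, rotated]) (use rt in \<open>simp add: innovation_diff\<close>)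
  have \<sigma>: "0 < sqrt ?h" using rt by simp
  have ev: "sets (natural_filtration M U r) \<subseteq> events" "space M \<in> sets (natural_filtration M U r)"
    using subalgebra_U[of r] sets.top[of "natural_filtration M U r"] by (auto simp: subalgebra_def)
  \<comment> \<open>\<open>W(1)\<close> is the normal law of the signed increment,
    \<open>W(2)\<close> its independence of the past of \<open>U\<close> at
    \<open>r\<close>.\<close>
  note W = indep_normal_of_char[OF \<sigma> _ ev char_signed_increment[OF rt]]
  have term1: "(\<integral>\<omega>. \<xi> \<omega> * iexp (l * ?W \<omega>) \<partial>M) = (\<integral>\<omega>. \<xi> \<omega> \<partial>M) * exp (- l\<^sup>2 * ?h / 2)"
  proof -
    have "(\<integral>\<omega>. \<xi> \<omega> * iexp (l * ?W \<omega>) \<partial>M) = (\<integral>\<omega>. \<xi> \<omega> \<partial>M) * (\<integral>\<omega>. iexp (l * ?W \<omega>) \<partial>M)"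
      using bd by (intro integral_indep_set_mult[OF subalgebra_U _ W(2) \<xi>] integrable_bounded_complex[of _ 1]) auto
    also have "(\<integral>\<omega>. iexp (l * ?W \<omega>) \<partial>M) = exp (- (l * sqrt ?h)\<^sup>2 / 2)"
      by (rule char_centered_normal[OF \<sigma> W(1)]) simp
    finally show ?thesis using rt by (simp add: power_mult_distrib)
  qed
  have term2: "(\<integral>\<omega>. \<xi> \<omega> * of_real (?D \<omega>) \<partial>M) = 0"
    using rt by (intro integral_residual[OF _ _ \<xi> bd]) auto
  have Dbd: "\<bar>?D \<omega>\<bar> \<le> 2 * \<bar>\<mu>\<bar> * ?h" if "\<omega> \<in> space M" for \<omega>
    using residual_bound[OF that, of r t] rt by simp
  have int: "integrable M (\<lambda>\<omega>. \<xi> \<omega> * iexp (l * ?Y \<omega>))" "integrable M (\<lambda>\<omega>. \<xi> \<omega> * iexp (l * ?W \<omega>))"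
    using bd by (auto intro!: integrable_bounded_complex[of _ 1] borel_measurable_times
        measurable_compose[OF YM, of "\<lambda>x. iexp (l * x)"] simp: norm_mult simp del: of_real_diff)
  have int3: "integrable M (\<lambda>\<omega>. (\<i> * l) * (\<xi> \<omega> * of_real (?D \<omega>)))"
  proof (intro integrable_mult_right integrable_bounded_complex[of _ "1 * (2 * \<bar>\<mu>\<bar> * ?h)"])
    show "cmod (\<xi> \<omega> * of_real (?D \<omega>)) \<le> 1 * (2 * \<bar>\<mu>\<bar> * ?h)" if "\<omega> \<in> space M" for \<omega>
      unfolding norm_mult norm_of_real using bd[of \<omega>] Dbd[OF that] by (intro mult_mono) auto
  qed measurable
  \<comment> \<open>The vanishing integral \<open>term2\<close> is inserted to complete the
    first-order expansion, so that only the pointwise remainder is left to estimate.\<close>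
  have "(\<integral>\<omega>. \<xi> \<omega> * iexp (l * ?Y \<omega>) \<partial>M) - (\<integral>\<omega>. \<xi> \<omega> \<partial>M) * exp (- l\<^sup>2 * ?h / 2) =
     (\<integral>\<omega>. \<xi> \<omega> * iexp (l * ?Y \<omega>) \<partial>M) - ((\<integral>\<omega>. \<xi> \<omega> * iexp (l * ?W \<omega>) \<partial>M) + (\<i> * l) * (\<integral>\<omega>. \<xi> \<omega> * of_real (?D \<omega>) \<partial>M))"
    unfolding term1 term2 by simp
  also have "\<dots> = (\<integral>\<omega>. \<xi> \<omega> * iexp (l * ?Y \<omega>) - (\<xi> \<omega> * iexp (l * ?W \<omega>) + (\<i> * l) * (\<xi> \<omega> * of_real (?D \<omega>))) \<partial>M)"
    using int int3 by (simp only: Bochner_Integration.integral_diff Bochner_Integration.integral_add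
      Bochner_Integration.integrable_add integral_mult_right_zero)
  finally have diff: "(\<integral>\<omega>. \<xi> \<omega> * iexp (l * ?Y \<omega>) \<partial>M) - (\<integral>\<omega>. \<xi> \<omega> \<partial>M) * exp (- l\<^sup>2 * ?h / 2) = \<dots>" .
  have "cmod ((\<integral>\<omega>. \<xi> \<omega> * iexp (l * ?Y \<omega>) \<partial>M) - (\<integral>\<omega>. \<xi> \<omega> \<partial>M) * exp (- l\<^sup>2 * ?h / 2)) \<le>
    (\<integral>\<omega>. 2 * l\<^sup>2 * \<mu>\<^sup>2 * ?h\<^sup>2 + 2 * l\<^sup>2 * \<bar>\<mu>\<bar> * ?h * \<bar>B t \<omega> - B r \<omega>\<bar> \<partial>M)"
    unfolding diff
  proof (rule order_trans[OF integral_norm_bound integral_mono])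
    show "integrable M (\<lambda>\<omega>. cmod (\<xi> \<omega> * iexp (l * ?Y \<omega>) - (\<xi> \<omega> * iexp (l * ?W \<omega>) + (\<i> * l) * (\<xi> \<omega> * of_real (?D \<omega>)))))"
      using int int3 by (intro integrable_norm Bochner_Integration.integrable_diff Bochner_Integration.integrable_add)
    show "integrable M (\<lambda>\<omega>. 2 * l\<^sup>2 * \<mu>\<^sup>2 * ?h\<^sup>2 + 2 * l\<^sup>2 * \<bar>\<mu>\<bar> * ?h * \<bar>B t \<omega> - B r \<omega>\<bar>)"
      using expectation_abs_increment(1)[OF rt] by auto
  next
    fix \<omega> assume \<omega>: "\<omega> \<in> space M"
    have Y: "?Y \<omega> = ?W \<omega> + ?D \<omega>" using innovation_diff[OF \<omega>, of r t] rt by simp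
    have W: "\<bar>?W \<omega>\<bar> = \<bar>B t \<omega> - B r \<omega>\<bar>" using sign[OF \<omega>] by (auto simp: abs_mult)
    have "\<xi> \<omega> * iexp (l * ?Y \<omega>) - (\<xi> \<omega> * iexp (l * ?W \<omega>) + (\<i> * l) * (\<xi> \<omega> * of_real (?D \<omega>))) =
      \<xi> \<omega> * (iexp (l * (?W \<omega> + ?D \<omega>)) - (iexp (l * ?W \<omega>) + \<i> * (l * ?D \<omega>)))"
    proof -
      have "x * e - (x * e' + (\<i> * c) * (x * d)) = x * (e - (e' + \<i> * (c * d)))" for x e e' c d :: complex
        by (simp add: algebra_simps)
      then show ?thesis unfolding Y of_real_mult .
    qed
    also have "cmod \<dots> \<le> 1 * (l\<^sup>2 * (?D \<omega>)\<^sup>2 / 2 + l\<^sup>2 * \<bar>?W \<omega>\<bar> * \<bar>?D \<omega>\<bar>)"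
      unfolding norm_mult by (intro mult_mono bd iexp_perturbation) auto
    \<comment> \<open>With the residual at most \<open>2 * \<bar>\<mu>\<bar> * ?h\<close>, only the
      increment of \<open>B\<close> stays random. Its mean modulus, at most \<open>sqrt ?h\<close>,
      gives the order 3/2.\<close>
    also have "\<dots> \<le> l\<^sup>2 * (2 * \<bar>\<mu>\<bar> * ?h)\<^sup>2 / 2 + l\<^sup>2 * \<bar>B t \<omega> - B r \<omega>\<bar> * (2 * \<bar>\<mu>\<bar> * ?h)"
    proof -
      have "\<bar>?D \<omega>\<bar>\<^sup>2 \<le> (2 * \<bar>\<mu>\<bar> * ?h)\<^sup>2" by (rule power_mono[OF Dbd[OF \<omega>]]) simp
      then show ?thesis unfolding mult_1 W
        by (intro add_mono mult_left_mono divide_right_mono Dbd[OF \<omega>]) auto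
    qed
    also have "\<dots> = 2 * l\<^sup>2 * \<mu>\<^sup>2 * ?h\<^sup>2 + 2 * l\<^sup>2 * \<bar>\<mu>\<bar> * ?h * \<bar>B t \<omega> - B r \<omega>\<bar>"
      by (simp add: power_mult_distrib)
    finally show "cmod (\<xi> \<omega> * iexp (l * ?Y \<omega>) - (\<xi> \<omega> * iexp (l * ?W \<omega>) + (\<i> * l) * (\<xi> \<omega> * of_real (?D \<omega>)))) \<le> \<dots>" .
  qed
  also have "\<dots> = 2 * l\<^sup>2 * \<mu>\<^sup>2 * ?h\<^sup>2 + 2 * l\<^sup>2 * \<bar>\<mu>\<bar> * ?h * (\<integral>\<omega>. \<bar>B t \<omega> - B r \<omega>\<bar> \<partial>M)"
    using expectation_abs_increment(1)[OF rt] by (simp add: prob_space)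
  also have "\<dots> \<le> 2 * l\<^sup>2 * \<mu>\<^sup>2 * ?h\<^sup>2 + 2 * l\<^sup>2 * \<bar>\<mu>\<bar> * ?h * sqrt ?h"
    using expectation_abs_increment(2)[OF rt] rt by (intro add_left_mono mult_left_mono) auto
  \<comment> \<open>Nonnegative cross terms are added to reach the form that
    \<open>constant_of_small_increments\<close> expects.\<close>
  also have "\<dots> \<le> 2 * l\<^sup>2 * (\<mu>\<^sup>2 + \<bar>\<mu>\<bar>) * (?h * (?h + sqrt ?h))"
  proof -
    have *: "2 * c * a * h\<^sup>2 + 2 * c * b * h * q \<le> 2 * c * (a + b) * (h * (h + q))"
      if "0 \<le> a" "0 \<le> b" "0 \<le> c" "0 \<le> h" "0 \<le> q" for a b c h q :: real
    proof -
      have "2 * c * (a + b) * (h * (h + q)) = 2 * c * a * h\<^sup>2 + 2 * c * b * h * q + 2 * c * (a * h * q + b * h\<^sup>2)"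
        by (simp add: algebra_simps power2_eq_square)
      moreover have "0 \<le> 2 * c * (a * h * q + b * h\<^sup>2)" using that by simp
      ultimately show ?thesis by linarith
    qed
    show ?thesis by (rule *) (use rt in simp_all)
  qed
  finally show ?thesis .
qed

text \<open>The weight \<open>\<xi> r\<close> collects the event \<open>A\<close> and the whole
  exponential accumulated since \<open>s\<close>. It is again bounded by 1 and known at time
  \<open>r\<close>, so the one-step estimate can be iterated; \<open>G\<close> compensates the
  Gaussian decay of each step.\<close>

lemma char_innovation:
  assumes st: "0 \<le> s" "s \<le> t" and A: "A \<in> sets (natural_filtration M U s)"
  shows "(\<integral>\<omega>. indicator A \<omega> * iexp (l * (innovation t \<omega> - innovation s \<omega>)) \<partial>M) = prob A * exp (- l\<^sup>2 * (t - s) / 2)"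
proof -
  define \<xi> where "\<xi> r \<omega> = indicator A \<omega> * iexp (l * (innovation r \<omega> - innovation s \<omega>))" for r \<omega>
  define g where "g r = (\<integral>\<omega>. \<xi> r \<omega> \<partial>M)" for r
  define G where "G r = g r * of_real (exp (l\<^sup>2 * r / 2))" for r
  let ?K = "2 * l\<^sup>2 * (\<mu>\<^sup>2 + \<bar>\<mu>\<bar>)"
  have \<xi>: "\<xi> r \<in> borel_measurable (natural_filtration M U r)" if "s \<le> r" for r
  proof -
    have "A \<in> sets (natural_filtration M U r)" using A natural_filtration_mono[OF that, of M U] by auto
    moreover have "(\<lambda>\<omega>. innovation r \<omega> - innovation s \<omega>) \<in> borel_measurable (natural_filtration M U r)"
      by (intro borel_measurable_diff innovation_measurable) (use st that in auto)
    ultimately show ?thesis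
      unfolding \<xi>_def
      by (intro borel_measurable_times borel_measurable_indicator
          measurable_compose[where f="\<lambda>\<omega>. innovation r \<omega> - innovation s \<omega>" and g="\<lambda>x. iexp (l * x)"]) auto
  qed
  have bd: "cmod (\<xi> r \<omega>) \<le> 1" for r \<omega>
    by (auto simp: \<xi>_def norm_mult split: split_indicator)
  \<comment> \<open>An increment of \<open>G\<close> carries the factor
    \<open>exp (l\<^sup>2 * (r + h) / 2)\<close>, bounded on all steps by its value at
    \<open>t\<close>; this is the extra factor in \<open>K\<close>.\<close>
  have "G t = G s"
  proof (rule constant_of_small_increments[OF st(2), where K="exp (l\<^sup>2 * t / 2) * ?K"])
    fix r h :: real assume r: "s \<le> r" "0 < h" "r + h \<le> t"
    have "\<xi> (r + h) \<omega> = \<xi> r \<omega> * iexp (l * (innovation (r + h) \<omega> - innovation r \<omega>))" for \<omega>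
      unfolding \<xi>_def by (simp add: exp_add[symmetric] algebra_simps)
    then have "(\<lambda>\<omega>. \<xi> r \<omega> * iexp (l * (innovation (r + h) \<omega> - innovation r \<omega>))) = \<xi> (r + h)" by auto
    moreover have "r + h - r = h" "0 \<le> r" "r < r + h" using st r by auto
    ultimately have "cmod (g (r + h) - g r * exp (- l\<^sup>2 * h / 2)) \<le> ?K * (h * (h + sqrt h))"
      unfolding g_def using char_innovation_step[OF _ _ \<xi>[OF r(1)] bd, of "r + h" l] by simp
    moreover have "G (r + h) - G r = (g (r + h) - g r * exp (- l\<^sup>2 * h / 2)) * of_real (exp (l\<^sup>2 * (r + h) / 2))"
    proof -
      have "exp (- l\<^sup>2 * h / 2) * exp (l\<^sup>2 * (r + h) / 2) = exp (l\<^sup>2 * r / 2)"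
        by (simp add: exp_add[symmetric] field_simps)
      then show ?thesis
        unfolding G_def left_diff_distrib mult.assoc of_real_mult[symmetric] by simp
    qed
    ultimately have "norm (G (r + h) - G r) \<le> ?K * (h * (h + sqrt h)) * exp (l\<^sup>2 * (r + h) / 2)"
      by (simp only: norm_mult norm_of_real abs_exp_cancel) (rule mult_right_mono, auto)
    also have "\<dots> \<le> ?K * (h * (h + sqrt h)) * exp (l\<^sup>2 * t / 2)"
      using r by (intro mult_left_mono) (auto intro!: mult_left_mono divide_right_mono)
    finally show "norm (G (r + h) - G r) \<le> exp (l\<^sup>2 * t / 2) * ?K * (h * (h + sqrt h))"
      by (simp add: mult_ac)
  qed
  moreover have "g s = prob A"
  proof -
    have "g s = (\<integral>\<omega>. of_real (indicator A \<omega>) \<partial>M)"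
      unfolding g_def \<xi>_def by (intro Bochner_Integration.integral_cong) (auto split: split_indicator)
    moreover have "A \<in> events" using A subalgebra_U[of s] by (auto simp: subalgebra_def)
    ultimately show ?thesis by (simp only: integral_complex_of_real) simp
  qed
  ultimately have "g t * of_real (exp (l\<^sup>2 * t / 2)) = prob A * of_real (exp (l\<^sup>2 * s / 2))"
    by (simp add: G_def)
  then have "g t * of_real (exp (l\<^sup>2 * t / 2)) * of_real (exp (- (l\<^sup>2 * t / 2))) =
     prob A * of_real (exp (l\<^sup>2 * s / 2)) * of_real (exp (- (l\<^sup>2 * t / 2)))" by simp
  then have "g t = prob A * exp (l\<^sup>2 * s / 2 + - (l\<^sup>2 * t / 2))"
    unfolding mult.assoc of_real_mult[symmetric] exp_add[symmetric] by simp
  also have "l\<^sup>2 * s / 2 + - (l\<^sup>2 * t / 2) = - l\<^sup>2 * (t - s) / 2" by (simp add: field_simps)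
  finally show ?thesis unfolding g_def \<xi>_def .
qed

end

section \<open>The theorem\<close>

text \<open>On each half-open grid interval the path is replaced by its value at the left endpoint,
  which is known there. The approximations are predictable and converge to the process by
  continuity.\<close>

lemma predictable_of_continuous_adapted:
  assumes sp: "\<And>t. space (F t) = \<Omega>"
    and meas: "\<And>t. 0 \<le> t \<Longrightarrow> X t \<in> borel_measurable (F t)"
    and cont: "\<And>\<omega>. \<omega> \<in> \<Omega> \<Longrightarrow> continuous_on {0..} (\<lambda>t. X t \<omega>)"
  shows "predictable \<Omega> F X"
proof -
  let ?G = "{{0} \<times> A | A. A \<in> sets (F 0)} \<union> {{s<..t} \<times> A | s t A. 0 \<le> s \<and> s < t \<and> A \<in> sets (F s)}"
  let ?P = "predictable_algebra \<Omega> F"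
  have G: "?G \<subseteq> Pow ({0..} \<times> \<Omega>)"
    using sets.sets_into_space sp by fastforce
  have P: "sets ?P = sigma_sets ({0..} \<times> \<Omega>) ?G" "space ?P = {0..} \<times> \<Omega>"
    unfolding predictable_algebra_def by (rule sets_measure_of[OF G], rule space_measure_of[OF G])
  \<comment> \<open>For \<open>t > 0\<close> this is the left endpoint of the interval of mesh
    \<open>1 / Suc n\<close>, open on the left and closed on the right, that contains
    \<open>t\<close>. At \<open>t = 0\<close> the quotient is negative and \<open>max 0\<close>
    returns 0.\<close>
  define q where "q n t = max 0 ((real_of_int \<lceil>t * real (Suc n)\<rceil> - 1) / real (Suc n))" for n t
  have q_lim: "(\<lambda>n. q n t) \<longlonglongrightarrow> t" if "0 \<le> t" for t
  proof (rule LIM_zero_cancel, rule Lim_null_comparison[OF _ LIMSEQ_inverse_real_of_nat])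
    have "norm (q n t - t) \<le> inverse (real (Suc n))" for n
    proof -
      have "(real_of_int \<lceil>t * real (Suc n)\<rceil> - 1) / real (Suc n) \<le> t"
        "t - inverse (real (Suc n)) \<le> (real_of_int \<lceil>t * real (Suc n)\<rceil> - 1) / real (Suc n)"
        by (simp_all add: field_simps del: of_nat_Suc) linarith+
      then show ?thesis using that unfolding q_def real_norm_def by linarith
    qed
    then show "\<forall>\<^sub>F n in sequentially. norm (q n t - t) \<le> inverse (real (Suc n))" by simp
  qed
  have q_nonneg: "0 \<le> q n t" for n t by (simp add: q_def)
  have q_interval: "q n t = real k / real (Suc n)" if "t \<in> {real k / real (Suc n)<..real (Suc k) / real (Suc n)}" for n k t
  proof -
    have "real k < t * real (Suc n)" "t * real (Suc n) \<le> real (Suc k)"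
      using that by (simp_all add: field_simps del: of_nat_Suc)
    then have "\<lceil>t * real (Suc n)\<rceil> = int k + 1" by (intro ceiling_unique) auto
    then show ?thesis by (simp add: q_def del: of_nat_Suc)
  qed
  have approx: "(\<lambda>p. X (q n (fst p)) (snd p)) \<in> borel_measurable ?P" for n
  proof (rule measurableI)
    fix C :: "real set" assume C: "C \<in> sets borel"
    let ?S = "\<lambda>k. {real k / real (Suc n)<..real (Suc k) / real (Suc n)} \<times> (X (real k / real (Suc n)) -` C \<inter> \<Omega>)"
    \<comment> \<open>The preimage splits into generators of the predictable sigma-algebra: one
      slice at time 0 and one rectangle for each grid interval.\<close>
    have "(\<lambda>p. X (q n (fst p)) (snd p)) -` C \<inter> space ?P = {0} \<times> (X 0 -` C \<inter> \<Omega>) \<union> (\<Union>k. ?S k)"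
    proof (intro subset_antisym subsetI)
      fix p assume "p \<in> (\<lambda>p. X (q n (fst p)) (snd p)) -` C \<inter> space ?P"
      then obtain t \<omega> where p: "p = (t, \<omega>)" "0 \<le> t" "\<omega> \<in> \<Omega>" "X (q n t) \<omega> \<in> C" by (auto simp: P)
      show "p \<in> {0} \<times> (X 0 -` C \<inter> \<Omega>) \<union> (\<Union>k. ?S k)"
      proof (cases "t = 0")
        case True
        then have "q n t = 0" by (simp add: q_def)
        then show ?thesis using p True by simp
      next
        case False
        define k where "k = nat (\<lceil>t * real (Suc n)\<rceil> - 1)"
        have "0 < t * real (Suc n)" using p False by simp
        then have "real k = real_of_int \<lceil>t * real (Suc n)\<rceil> - 1" by (simp add: k_def del: of_nat_Suc)
        then have "real k < t * real (Suc n)" "t * real (Suc n) \<le> real k + 1" by linarith+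
        then have t: "t \<in> {real k / real (Suc n)<..real (Suc k) / real (Suc n)}"
          by (simp add: field_simps)
        then show ?thesis using p q_interval[OF t] by auto
      qed
    next
      fix p assume "p \<in> {0} \<times> (X 0 -` C \<inter> \<Omega>) \<union> (\<Union>k. ?S k)"
      then show "p \<in> (\<lambda>p. X (q n (fst p)) (snd p)) -` C \<inter> space ?P"
      proof
        assume "p \<in> {0} \<times> (X 0 -` C \<inter> \<Omega>)"
        then show ?thesis by (auto simp: P q_def)
      next
        assume "p \<in> (\<Union>k. ?S k)"
        then obtain k t \<omega> where p: "p = (t, \<omega>)" "t \<in> {real k / real (Suc n)<..real (Suc k) / real (Suc n)}"
            "X (real k / real (Suc n)) \<omega> \<in> C" "\<omega> \<in> \<Omega>" by auto
        have "0 \<le> real k / real (Suc n)" by simp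
        then have "0 \<le> t" using p(2) by (metis greaterThanAtMost_iff less_imp_le order_trans)
        then show ?thesis using p q_interval[OF p(2)] by (simp add: P del: of_nat_Suc)
      qed
    qed
    also have "\<dots> \<in> sets ?P"
    proof (intro sets.Un sets.countable_UN image_subsetI)
      have "X 0 -` C \<inter> \<Omega> \<in> sets (F 0)" using measurable_sets[OF meas C, of 0] sp by simp
      then show "{0} \<times> (X 0 -` C \<inter> \<Omega>) \<in> sets ?P" unfolding P by (intro sigma_sets.Basic) blast
    next
      fix k
      have "X (real k / real (Suc n)) -` C \<inter> \<Omega> \<in> sets (F (real k / real (Suc n)))"
        using measurable_sets[OF meas C, of "real k / real (Suc n)"] sp by simp
      moreover have "0 \<le> real k / real (Suc n)" "real k / real (Suc n) < real (Suc k) / real (Suc n)"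
        by (simp_all add: field_simps)
      ultimately show "?S k \<in> sets ?P" unfolding P by (intro sigma_sets.Basic) blast
    qed
    finally show "(\<lambda>p. X (q n (fst p)) (snd p)) -` C \<inter> space ?P \<in> sets ?P" .
  qed simp
  have "(\<lambda>p. X (fst p) (snd p)) \<in> borel_measurable ?P"
  proof (rule borel_measurable_LIMSEQ_real[OF _ approx])
    fix p assume "p \<in> space ?P"
    then have p: "0 \<le> fst p" "snd p \<in> \<Omega>" by (auto simp: P)
    show "(\<lambda>n. X (q n (fst p)) (snd p)) \<longlonglongrightarrow> X (fst p) (snd p)"
      using continuous_on_tendsto_compose[OF cont[OF p(2)] q_lim[OF p(1)]] p q_nonneg by simp
  qed
  then show ?thesis unfolding predictable_def by (simp add: split_beta')
qed

section \<open>Transfer to the completed right-continuous filtration\<close>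

lemma borel_measurable_completion_AE_eq:
  assumes f: "f \<in> borel_measurable M" and eq: "AE \<omega> in M. g \<omega> = f \<omega>"
  shows "g \<in> borel_measurable (completion M)"
proof (rule measurableI)
  fix A :: "'b::topological_space set" assume "A \<in> sets borel"
  then have "f -` A \<inter> space (completion M) \<in> sets (completion M)"
    using measurable_sets[OF f] by simp
  from completion.in_sets_AE[OF _ this, of "g -` A \<inter> space (completion M)"]
  show "g -` A \<inter> space (completion M) \<in> sets (completion M)"
  proof
    show "AE \<omega> in completion M. (\<omega> \<in> f -` A \<inter> space (completion M)) = (\<omega> \<in> g -` A \<inter> space (completion M))"
      using AE_completion[OF eq] by eventually_elim simp
  qed auto
qed simp

lemma filtration_generated: "filtration (space M) (generated_filtration M X)"
proof
  fix i j :: real assume "i \<le> j"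
  then show "sets (generated_filtration M X i) \<subseteq> sets (generated_filtration M X j)"
    unfolding sets_generated_filtration by auto
qed simp

context brownian_with_sign
begin

lemma innovation_0: "innovation 0 \<omega> = 0" if "\<omega> \<in> space M"
proof -
  have "drift 0 \<omega> = 0"
    unfolding drift_def set_lebesgue_integral_def
    by (rule integral_eq_zero_AE) (use AE_lborel_singleton[of "0::real"] in \<open>auto elim!: eventually_mono\<close>)
  then show ?thesis using B_0[OF that] by (simp add: innovation_def)
qed

lemma innovation_eq_sign_times:
  assumes \<omega>: "\<omega> \<in> space M" and t: "0 \<le> t"
  shows "\<epsilon> \<omega> * ((LBINT u:{0..t}. \<mu> * (1 - tanh (\<mu> * X u \<omega>))) + B t \<omega>) = innovation t \<omega>"
proof -
  have tanh_sign: "tanh (\<mu> * U u \<omega>) = \<epsilon> \<omega> * tanh (\<mu> * X u \<omega>)" for u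
  proof -
    have "\<mu> * U u \<omega> = \<epsilon> \<omega> * (\<mu> * X u \<omega>)" by simp
    then show ?thesis using sign[OF \<omega>] by (elim disjE) (simp_all only: mult_1 mult_minus_left tanh_minus)
  qed
  have eps2: "\<epsilon> \<omega> * \<epsilon> \<omega> = 1" using sign[OF \<omega>] by auto
  have "tanh (\<mu> * X u \<omega>) = \<epsilon> \<omega> * tanh (\<mu> * U u \<omega>)" for u
    unfolding tanh_sign using eps2 by (simp add: mult.assoc[symmetric])
  then have "(LBINT u:{0..t}. \<mu> * (1 - tanh (\<mu> * X u \<omega>))) =
      \<mu> * ((LBINT u:{0..t}. 1) - (LBINT u:{0..t}. \<epsilon> \<omega> * tanh (\<mu> * U u \<omega>)))"
    using set_integrable_mult_right[OF tanh_U_set_integrable(1)[OF \<omega>, of 0 t], of "\<epsilon> \<omega>"] t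
    by (subst set_integral_diff(2)[symmetric]) (auto simp: set_integrable_def)
  also have "\<dots> = \<mu> * (t - \<epsilon> \<omega> * drift t \<omega>)"
    using t by (simp add: drift_def set_lebesgue_integral_def)
  finally have int: "(LBINT u:{0..t}. \<mu> * (1 - tanh (\<mu> * X u \<omega>))) = \<mu> * (t - \<epsilon> \<omega> * drift t \<omega>)" .
  have "\<epsilon> \<omega> * ((LBINT u:{0..t}. \<mu> * (1 - tanh (\<mu> * X u \<omega>))) + B t \<omega>) =
     \<epsilon> \<omega> * (\<mu> * t + B t \<omega>) - \<mu> * ((\<epsilon> \<omega> * \<epsilon> \<omega>) * drift t \<omega>)"
    unfolding int by (simp add: algebra_simps)
  then show ?thesis unfolding eps2 innovation_def by (simp add: algebra_simps)
qed

text \<open>An event of the generated filtration at \<open>s\<close> lies in the saturated one at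
  each \<open>r > s\<close>, so it agrees almost everywhere with an event of the past of the
  innovation at \<open>r\<close>. \<open>char_gap\<close> uses this for increments starting at
  \<open>r\<close>; \<open>char\<close> lets \<open>r\<close> decrease to \<open>s\<close>.\<close>

lemma brownian_motion_in_own_filtration_innovation:
  assumes Y: "AE \<omega> in M. \<forall>t\<ge>0. Y t \<omega> = innovation t \<omega>"
  shows "brownian_motion_in_own_filtration M Y"
proof -
  let ?C = "completion M"
  let ?F = "generated_filtration M Y"
  interpret C: prob_space ?C by (rule prob_space_completion)
  have YI: "AE \<omega> in M. Y t \<omega> = innovation t \<omega>" if "0 \<le> t" for t
    using Y by eventually_elim (use that in simp)
  have Y_meas: "Y t \<in> borel_measurable ?C" if "0 \<le> t" for t
    by (rule borel_measurable_completion_AE_eq[OF innovation_measurable_M[OF that] YI[OF that]])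
  have sat: "sets (saturated_filtration M Y t) \<subseteq> sets ?C" for t
  proof -
    have "sets (natural_filtration M Y t) \<subseteq> sets ?C"
      by (rule sets_natural_filtration_subset) (auto intro: Y_meas)
    then show ?thesis
      unfolding sets_saturated_filtration
      using sets.sigma_sets_subset[of "sets (natural_filtration M Y t) \<union> null_sets ?C" ?C] by auto
  qed
  have sub: "subalgebra ?C (?F t)" for t
    unfolding subalgebra_def sets_generated_filtration
    using sat[of "t + 1"] by auto
  have char_gap: "(\<integral>\<omega>. indicator A \<omega> * iexp (l * (innovation t \<omega> - innovation r \<omega>)) \<partial>?C) =
      C.prob A * exp (- l\<^sup>2 * (t - r) / 2)"
    if A: "A \<in> sets (?F s)" and r: "0 \<le> s" "s < r" "r \<le> t" for A s r t l
  proof -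
    have "A \<in> sets (saturated_filtration M Y r)" using A r unfolding sets_generated_filtration by auto
    then obtain A' where A': "A' \<in> sets (natural_filtration M innovation r)"
      and AE: "AE \<omega> in ?C. \<omega> \<in> A \<longleftrightarrow> \<omega> \<in> A'"
      using saturated_filtration_AE_eq[where t=r and X=Y and Y=innovation and A=A and M=M] AE_completion[OF YI] by blast
    \<comment> \<open>The innovation is adapted to \<open>U\<close>, so the identity proved for
      events of \<open>U\<close> covers those of the smaller filtration.\<close>
    have "sets (natural_filtration M innovation r) \<subseteq> sets (natural_filtration M U r)"
      by (rule sets_natural_filtration_subset) (auto intro: innovation_measurable)
    then have A'U: "A' \<in> sets (natural_filtration M U r)" using A' by auto
    then have [measurable]: "A' \<in> events" using subalgebra_U[of r] by (auto simp: subalgebra_def)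
    have [measurable]: "A \<in> sets ?C" using A sub[of s] by (auto simp: subalgebra_def)
    have IM[measurable]: "innovation t \<in> borel_measurable M" "innovation r \<in> borel_measurable M"
      using r by (auto intro: innovation_measurable_M)
    have m: "(\<lambda>\<omega>. indicator A' \<omega> * iexp (l * (innovation t \<omega> - innovation r \<omega>))) \<in> borel_measurable M"
      by measurable
    have IC[measurable]: "innovation t \<in> borel_measurable ?C" "innovation r \<in> borel_measurable ?C"
      using IM by (auto intro: measurable_completion)
    have "(\<integral>\<omega>. indicator A \<omega> * iexp (l * (innovation t \<omega> - innovation r \<omega>)) \<partial>?C) =
      (\<integral>\<omega>. indicator A' \<omega> * iexp (l * (innovation t \<omega> - innovation r \<omega>)) \<partial>?C)"
    proof (rule integral_cong_AE)
      show "(\<lambda>\<omega>. indicator A' \<omega> * iexp (l * (innovation t \<omega> - innovation r \<omega>))) \<in> borel_measurable ?C"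
        using m by (rule measurable_completion)
      show "AE \<omega> in ?C. indicator A \<omega> * iexp (l * (innovation t \<omega> - innovation r \<omega>)) =
        indicator A' \<omega> * iexp (l * (innovation t \<omega> - innovation r \<omega>))"
        using AE by eventually_elim (simp add: indicator_def)
    qed measurable
    also have "\<dots> = (\<integral>\<omega>. indicator A' \<omega> * iexp (l * (innovation t \<omega> - innovation r \<omega>)) \<partial>M)"
      by (rule integral_completion[OF m])
    also have "\<dots> = prob A' * exp (- l\<^sup>2 * (t - r) / 2)"
      using r by (intro char_innovation[OF _ _ A'U]) auto
    also have "prob A' = C.prob A'" by simp
    also have "\<dots> = C.prob A" using AE by (intro C.finite_measure_eq_AE) auto
    finally show ?thesis .
  qed
  have char: "(\<integral>\<omega>. indicator A \<omega> * iexp (l * (Y t \<omega> - Y s \<omega>)) \<partial>?C) = C.prob A * exp (- (l * sqrt (t - s))\<^sup>2 / 2)"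
    if A: "A \<in> sets (?F s)" and st: "0 \<le> s" "s < t" for A s t l
  proof -
    \<comment> \<open>The times stay strictly above \<open>s\<close>, as \<open>char_gap\<close>
      requires, and start at \<open>r 0 = t\<close>. The integrands have modulus at most 1, so
      dominated convergence applies along the continuous innovation paths.\<close>
    define r where "r n = s + (t - s) / real (Suc n)" for n
    have r: "s < r n" "r n \<le> t" for n
    proof -
      have "(t - s) / real (Suc n) \<le> (t - s) / 1" using st by (intro divide_left_mono) auto
      then show "s < r n" "r n \<le> t" using st by (simp_all add: r_def del: of_nat_Suc)
    qed
    have r_lim: "r \<longlonglongrightarrow> s"
      unfolding r_def using tendsto_add[OF tendsto_const LIMSEQ_Suc[OF lim_const_over_n[of "t - s"]], of s] by simp
    have [measurable]: "A \<in> sets ?C" using A sub[of s] by (auto simp: subalgebra_def)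
    have IC: "innovation u \<in> borel_measurable ?C" if "0 \<le> u" for u
      using innovation_measurable_M[OF that] by (rule measurable_completion)
    have [measurable]: "innovation t \<in> borel_measurable ?C" "innovation s \<in> borel_measurable ?C"
      "innovation (r n) \<in> borel_measurable ?C" for n
      using st r[of n] by (auto intro!: IC)
    have [measurable]: "Y t \<in> borel_measurable ?C" "Y s \<in> borel_measurable ?C"
      using st by (auto intro!: Y_meas)
    have "(\<lambda>n. \<integral>\<omega>. indicator A \<omega> * iexp (l * (innovation t \<omega> - innovation (r n) \<omega>)) \<partial>?C) \<longlonglongrightarrow>
      (\<integral>\<omega>. indicator A \<omega> * iexp (l * (innovation t \<omega> - innovation s \<omega>)) \<partial>?C)"
    proof (rule integral_dominated_convergence[where w="\<lambda>_. 1"])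
      show "AE \<omega> in ?C. (\<lambda>n. indicator A \<omega> * iexp (l * (innovation t \<omega> - innovation (r n) \<omega>)))
        \<longlonglongrightarrow> indicator A \<omega> * iexp (l * (innovation t \<omega> - innovation s \<omega>))"
      proof (rule AE_I2)
        fix \<omega> assume "\<omega> \<in> space ?C"
        then have "(\<lambda>n. innovation (r n) \<omega>) \<longlonglongrightarrow> innovation s \<omega>"
          using continuous_on_tendsto_compose[OF innovation_cont r_lim] st r(1)
          by (auto intro!: eventuallyI simp: less_imp_le[OF order_le_less_trans])
        then show "(\<lambda>n. indicator A \<omega> * iexp (l * (innovation t \<omega> - innovation (r n) \<omega>)))
          \<longlonglongrightarrow> indicator A \<omega> * iexp (l * (innovation t \<omega> - innovation s \<omega>))"
          by (intro tendsto_intros)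
      qed
      show "AE \<omega> in ?C. norm (indicator A \<omega> * iexp (l * (innovation t \<omega> - innovation (r n) \<omega>))) \<le> 1" for n
        by (intro AE_I2) (auto simp: norm_mult split: split_indicator)
    qed (simp_all, measurable)
    moreover have "(\<lambda>n. complex_of_real (C.prob A * exp (- l\<^sup>2 * (t - r n) / 2))) \<longlonglongrightarrow>
      complex_of_real (C.prob A * exp (- l\<^sup>2 * (t - s) / 2))"
      using r_lim by (intro tendsto_intros) simp_all
    ultimately have "(\<integral>\<omega>. indicator A \<omega> * iexp (l * (innovation t \<omega> - innovation s \<omega>)) \<partial>?C) =
        C.prob A * exp (- l\<^sup>2 * (t - s) / 2)"
      unfolding char_gap[OF A st(1) r] by (rule LIMSEQ_unique)
    moreover have "(\<integral>\<omega>. indicator A \<omega> * iexp (l * (Y t \<omega> - Y s \<omega>)) \<partial>?C) =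
      (\<integral>\<omega>. indicator A \<omega> * iexp (l * (innovation t \<omega> - innovation s \<omega>)) \<partial>?C)"
    proof (rule integral_cong_AE)
      show "AE \<omega> in ?C. indicator A \<omega> * iexp (l * (Y t \<omega> - Y s \<omega>)) =
        indicator A \<omega> * iexp (l * (innovation t \<omega> - innovation s \<omega>))"
        using AE_completion[OF Y] by eventually_elim (use st in simp)
    qed measurable
    ultimately show ?thesis using st by (simp add: power_mult_distrib)
  qed
  have incr: "distributed ?C lborel (\<lambda>\<omega>. Y t \<omega> - Y s \<omega>) (normal_density 0 (sqrt (t - s)))"
      "C.indep_set (sets (?F s)) (sets (vimage_algebra (space M) (\<lambda>\<omega>. Y t \<omega> - Y s \<omega>) borel))"
    if st: "0 \<le> s" "s < t" for s t
  proof -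
    have 1: "0 < sqrt (t - s)" and 2: "(\<lambda>\<omega>. Y t \<omega> - Y s \<omega>) \<in> borel_measurable ?C"
      and 3: "sets (?F s) \<subseteq> C.events" and 4: "space ?C \<in> sets (?F s)"
      using st sub[of s] sets.top[of "?F s"] by (auto intro!: borel_measurable_diff Y_meas simp: subalgebra_def)
    note I = C.indep_normal_of_char[OF 1 2 3 4 char[OF _ st]]
    show "distributed ?C lborel (\<lambda>\<omega>. Y t \<omega> - Y s \<omega>) (normal_density 0 (sqrt (t - s)))" by (rule I(1))
    show "C.indep_set (sets (?F s)) (sets (vimage_algebra (space M) (\<lambda>\<omega>. Y t \<omega> - Y s \<omega>) borel))"
      using I(2) by simp
  qed
  have adapted: "Y t \<in> borel_measurable (?F t)" if "0 \<le> t" for t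
  proof (rule measurableI)
    fix A :: "real set" assume "A \<in> sets borel"
    then have "Y t -` A \<inter> space M \<in> sets (natural_filtration M Y t)"
      using that by (auto simp: sets_natural_filtration)
    then show "Y t -` A \<inter> space (?F t) \<in> sets (?F t)"
      using natural_subset_saturated saturated_subset_generated by (metis space_generated_filtration subsetD)
  qed simp
  have AE_paths: "AE \<omega> in M. \<omega> \<in> space M \<and> (\<forall>t\<ge>0. Y t \<omega> = innovation t \<omega>)"
    using Y AE_space by eventually_elim simp
  have "AE \<omega> in M. Y 0 \<omega> = 0"
    using AE_paths by eventually_elim (simp add: innovation_0)
  moreover have "AE \<omega> in M. continuous_on {0..} (\<lambda>t. Y t \<omega>)"
    using AE_paths
  proof eventually_elim
    fix \<omega> assume "\<omega> \<in> space M \<and> (\<forall>t\<ge>0. Y t \<omega> = innovation t \<omega>)"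
    then show "continuous_on {0..} (\<lambda>t. Y t \<omega>)"
      using innovation_cont[of \<omega>]
        continuous_on_cong[of "{0..}" "{0..}" "\<lambda>t. Y t \<omega>" "\<lambda>t. innovation t \<omega>"] by auto
  qed
  ultimately show ?thesis
    unfolding brownian_motion_in_own_filtration_def brownian_motion_wrt_def
    using incr adapted sub filtration_generated[of M Y] C.prob_space_axioms by (simp add: AE_completion_iff)
qed

end

theorem proposition1p1:
  fixes M :: "'a measure"
    and B :: "real \<Rightarrow> 'a \<Rightarrow> real"
    and \<epsilon> :: "'a \<Rightarrow> real"
    and \<mu> :: real
  assumes "prob_space M"
    and "standard_brownian_motion M B"
    and "\<epsilon> \<in> borel_measurable M"
    and "measure M {\<omega> \<in> space M. \<epsilon> \<omega> = 1} = 1 / 2"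
    and "measure M {\<omega> \<in> space M. \<epsilon> \<omega> = -1} = 1 / 2"
    and "prob_space.indep_set M
           (sets (vimage_algebra (space M) \<epsilon> borel))
           (sets (vimage_algebra (space M) (\<lambda>\<omega>. \<lambda>t\<in>{0..}. B t \<omega>) (Pi\<^sub>M {0..} (\<lambda>_. borel))))"
    and "\<mu> > 0"
  shows "\<exists>m :: real \<Rightarrow> 'a \<Rightarrow> real.
      predictable (space M) (generated_filtration M B) m \<and>
      (\<forall>t\<ge>0. \<forall>\<omega>\<in>space M. m t \<omega> \<in> {0<..<2 * \<mu>}) \<and>
      brownian_motion_in_own_filtration M (\<lambda>t \<omega>. \<epsilon> \<omega> * drift_process m B t \<omega>)"
proof -
  interpret prob_space M by fact
  have sub: "\<And>t. 0 \<le> t \<Longrightarrow> subalgebra M (natural_filtration M B t)"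
    and B0: "AE \<omega> in M. B 0 \<omega> = 0"
    and Bc: "AE \<omega> in M. continuous_on {0..} (\<lambda>t. B t \<omega>)"
    and normal: "\<And>s t. 0 \<le> s \<Longrightarrow> s < t \<Longrightarrow>
        distributed M lborel (\<lambda>\<omega>. B t \<omega> - B s \<omega>) (normal_density 0 (sqrt (t - s)))"
    and indep: "\<And>s t. 0 \<le> s \<Longrightarrow> s < t \<Longrightarrow> indep_set (sets (natural_filtration M B s))
          (sets (vimage_algebra (space M) (\<lambda>\<omega>. B t \<omega> - B s \<omega>) borel))"
    using assms(2) unfolding standard_brownian_motion_def brownian_motion_wrt_def by auto
  note [measurable] = assms(3)
  have B_meas: "B t \<in> borel_measurable M" if "0 \<le> t" for t
    by (rule measurable_from_subalg[OF sub[OF that] measurable_natural_filtration]) (use that in auto)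
  have "AE \<omega> in M. B 0 \<omega> = 0 \<and> continuous_on {0..} (\<lambda>t. B t \<omega>)"
    using B0 Bc by eventually_elim simp
  then obtain N where N: "N \<in> null_sets M"
    and good: "\<And>\<omega>. \<omega> \<in> space M \<Longrightarrow> \<omega> \<notin> N \<Longrightarrow> B 0 \<omega> = 0 \<and> continuous_on {0..} (\<lambda>t. B t \<omega>)"
    by (auto elim!: AE_E3)
  have [measurable]: "N \<in> events" using N by auto
  \<comment> \<open>The zero path replaces \<open>B\<close> on \<open>N\<close>;
    \<open>max 0 t\<close> freezes the path before time 0, which extends continuity from
    \<open>{0..}\<close> to the whole line.\<close>
  define B' where "B' t \<omega> = (if \<omega> \<in> N then 0 else B (max 0 t) \<omega>)" for t \<omega>
  \<comment> \<open>The default -1 also covers the null set on which \<open>\<epsilon>\<close> is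
    neither 1 nor -1.\<close>
  define \<epsilon>' where "\<epsilon>' \<omega> = (if \<epsilon> \<omega> = 1 then 1 else -1 :: real)" for \<omega>
  have notN: "AE \<omega> in M. \<omega> \<notin> N" by (rule AE_not_in[OF N])
  have BB': "AE \<omega> in M. B' t \<omega> = B t \<omega>" if "0 \<le> t" for t
    using notN by eventually_elim (use that in \<open>simp add: B'_def\<close>)
  have ee': "AE \<omega> in M. \<epsilon>' \<omega> = \<epsilon> \<omega>"
  proof -
    have "prob ({\<omega> \<in> space M. \<epsilon> \<omega> = 1} \<union> {\<omega> \<in> space M. \<epsilon> \<omega> = -1}) = 1"
      by (subst finite_measure_Union) (use assms(4,5) in auto)
    then have "AE \<omega> in M. \<omega> \<in> {\<omega> \<in> space M. \<epsilon> \<omega> = 1} \<union> {\<omega> \<in> space M. \<epsilon> \<omega> = -1}"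
      by (rule AE_prob_1)
    then show ?thesis by eventually_elim (auto simp: \<epsilon>'_def)
  qed
  have B'_meas[measurable]: "B' t \<in> borel_measurable M" for t
    unfolding B'_def using B_meas[of "max 0 t"] by measurable
  have \<epsilon>'_meas[measurable]: "\<epsilon>' \<in> borel_measurable M" unfolding \<epsilon>'_def by measurable
  \<comment> \<open>\<open>B'\<close> and \<open>\<epsilon>'\<close> are everywhere well-behaved versions; \<open>m\<close> built from \<open>B'\<close> remains predictable
    because the filtration contains the null set \<open>N\<close>.\<close>
  have natural_AE: "\<exists>A'\<in>sets (natural_filtration M B t). AE \<omega> in M. \<omega> \<in> A \<longleftrightarrow> \<omega> \<in> A'"
    if "A \<in> sets (natural_filtration M B' t)" for A t
    using saturated_filtration_AE_eq[where t=t and X=B' and Y=B and A=A and M=M] AE_completion[OF BB'] natural_subset_saturated[of M B' t] that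
    by (auto simp: AE_completion_iff)
  have natural_events: "sets (natural_filtration M B' t) \<subseteq> events" for t
    by (rule sets_natural_filtration_subset) auto
  have vimage_AE: "\<exists>b'\<in>sets (vimage_algebra (space M) R' borel). AE \<omega> in M. \<omega> \<in> b \<longleftrightarrow> \<omega> \<in> b'"
    if R: "AE \<omega> in M. R \<omega> = R' \<omega>" and b: "b \<in> sets (vimage_algebra (space M) R borel)"
    for R R' :: "'a \<Rightarrow> real" and b
  proof -
    obtain C where C: "C \<in> sets borel" "b = R -` C \<inter> space M" using b by (auto simp: sets_vimage_borel)
    have "AE \<omega> in M. \<omega> \<in> b \<longleftrightarrow> \<omega> \<in> R' -` C \<inter> space M"
      using R by eventually_elim (simp add: C)
    then show ?thesis
      by (intro bexI[of _ "R' -` C \<inter> space M"]) (use C(1) in \<open>auto simp: sets_vimage_borel\<close>)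
  qed
  have vimage_events: "sets (vimage_algebra (space M) R borel) \<subseteq> events" if "R \<in> borel_measurable M"
    for R :: "'a \<Rightarrow> real"
    using measurable_sets[OF that] by (auto simp: sets_vimage_borel)
  interpret brownian_with_sign M B' \<epsilon>' \<mu>
  proof
    show "continuous_on UNIV (\<lambda>t. B' t \<omega>)" if "\<omega> \<in> space M" for \<omega>
    proof (cases "\<omega> \<in> N")
      case False
      then have "continuous_on {0..} (\<lambda>t. B t \<omega>)" using good that by auto
      then have "continuous_on UNIV (\<lambda>t. B (max 0 t) \<omega>)"
        by (rule continuous_on_compose2) (intro continuous_intros, auto)
      then show ?thesis using False by (simp add: B'_def)
    qed (simp add: B'_def)
    show "B' 0 \<omega> = 0" if "\<omega> \<in> space M" for \<omega> using good[OF that] by (simp add: B'_def)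
    show "\<epsilon>' \<omega> = 1 \<or> \<epsilon>' \<omega> = -1" for \<omega> by (simp add: \<epsilon>'_def)
    have "{\<omega> \<in> space M. \<epsilon>' \<omega> = 1} = {\<omega> \<in> space M. \<epsilon> \<omega> = 1}" by (auto simp: \<epsilon>'_def)
    then show "prob {\<omega> \<in> space M. \<epsilon>' \<omega> = 1} = 1 / 2" using assms(4) by simp
  next
    fix s t :: real assume st: "0 \<le> s" "s < t"
    have eq: "AE \<omega> in M. B' t \<omega> - B' s \<omega> = B t \<omega> - B s \<omega>"
      using BB'[of t] BB'[of s] st by auto
    have [measurable]: "B t \<in> borel_measurable M" "B s \<in> borel_measurable M"
      using B_meas st by auto
    have "distr M lborel (\<lambda>\<omega>. B' t \<omega> - B' s \<omega>) = distr M lborel (\<lambda>\<omega>. B t \<omega> - B s \<omega>)"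
      by (rule distr_cong_AE) (use eq in auto)
    then show "distributed M lborel (\<lambda>\<omega>. B' t \<omega> - B' s \<omega>) (normal_density 0 (sqrt (t - s)))"
      using normal[OF st] by (simp add: distributed_def)
    show "indep_set (sets (natural_filtration M B' s))
        (sets (vimage_algebra (space M) (\<lambda>\<omega>. B' t \<omega> - B' s \<omega>) borel))"
      by (rule indep_set_AE_eq[OF indep[OF st] natural_events vimage_events natural_AE vimage_AE[OF eq]]) measurable
  next
    fix t :: real assume t: "0 \<le> t"
    let ?V = "vimage_algebra (space M) (\<lambda>\<omega>. \<lambda>t\<in>{0..}. B t \<omega>) (Pi\<^sub>M {0..} (\<lambda>_. borel))"
    have path: "(\<lambda>\<omega>. \<lambda>t\<in>{0..}. B t \<omega>) \<in> ?V \<rightarrow>\<^sub>M Pi\<^sub>M {0..} (\<lambda>_. borel)"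
      by (rule measurable_vimage_algebra1) (auto simp: space_PiM)
    \<comment> \<open>Each \<open>B u\<close> is a coordinate of the path map, so independence of
      \<open>\<epsilon>\<close> from the whole path passes to every finite horizon
      \<open>t\<close>.\<close>
    have V: "sets (natural_filtration M B t) \<subseteq> sets ?V"
    proof (rule sets_natural_filtration_subset)
      fix u :: real assume "0 \<le> u"
      then have "(\<lambda>\<omega>. (\<lambda>t\<in>{0..}. B t \<omega>) u) \<in> borel_measurable ?V"
        by (intro measurable_compose[OF path measurable_component_singleton]) auto
      then show "B u \<in> borel_measurable ?V" using \<open>0 \<le> u\<close> by simp
    qed simp
    have "indep_set (sets (natural_filtration M B t)) (sets (vimage_algebra (space M) \<epsilon> borel))"
    proof (rule indep_setI)
      show "sets (natural_filtration M B t) \<subseteq> events" using sub[OF t] by (simp add: subalgebra_def)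
      show "sets (vimage_algebra (space M) \<epsilon> borel) \<subseteq> events" by (rule vimage_events) measurable
      fix a b assume ab: "a \<in> sets (natural_filtration M B t)" "b \<in> sets (vimage_algebra (space M) \<epsilon> borel)"
      then have "prob (b \<inter> a) = prob b * prob a" using V by (intro indep_setD[OF assms(6)]) auto
      then show "prob (a \<inter> b) = prob a * prob b" by (simp add: Int_commute mult.commute)
    qed
    then show "indep_set (sets (natural_filtration M B' t)) (sets (vimage_algebra (space M) \<epsilon>' borel))"
      by (rule indep_set_AE_eq[OF _ natural_events vimage_events natural_AE vimage_AE[OF ee']]) measurable
  qed measurable
  \<comment> \<open>Here \<open>X\<close> is formed from \<open>B'\<close>, so every path of
    \<open>m\<close> is continuous, as the predictability lemma asks. The open interval reflects the
    strict bounds -1 and 1 of \<open>tanh\<close>.\<close>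
  define m where "m t \<omega> = \<mu> * (1 - tanh (\<mu> * X t \<omega>))" for t \<omega>
  have "predictable (space M) (generated_filtration M B) m"
  proof (rule predictable_of_continuous_adapted)
    fix t :: real assume t: "0 \<le> t"
    let ?F = "generated_filtration M B t"
    have sets: "sets (natural_filtration M B t) \<subseteq> sets ?F" "N \<in> sets ?F"
      using natural_subset_saturated[of M B t] saturated_subset_generated[of M B t]
        null_subset_saturated[of M B t] null_sets_completionI[OF N] by auto
    have "B t \<in> borel_measurable ?F"
      by (rule measurable_from_subalg[of _ "natural_filtration M B t"])
        (use sets t measurable_natural_filtration[OF t] in \<open>auto simp: subalgebra_def\<close>)
    moreover have "B' t = (\<lambda>\<omega>. if \<omega> \<in> N then 0 else B t \<omega>)" using t by (simp add: B'_def fun_eq_iff)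
    ultimately have [measurable]: "B' t \<in> borel_measurable ?F"
      using sets(2) by (auto intro!: measurable_If_set)
    show "m t \<in> borel_measurable ?F"
      unfolding m_def
      by (intro borel_measurable_times borel_measurable_diff borel_measurable_add borel_measurable_const
          measurable_compose[OF _ measurable_tanh_real]) fact
  next
    fix \<omega> assume "\<omega> \<in> space M"
    then show "continuous_on {0..} (\<lambda>t. m t \<omega>)"
      unfolding m_def by (intro continuous_intros continuous_on_subset[OF B_cont]) auto
  qed simp
  moreover have "m t \<omega> \<in> {0<..<2 * \<mu>}" for t \<omega>
    using assms(7) tanh_real_bounds[of "\<mu> * X t \<omega>"] by (auto simp: m_def)
  moreover have "brownian_motion_in_own_filtration M (\<lambda>t \<omega>. \<epsilon> \<omega> * drift_process m B t \<omega>)"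
  proof (rule brownian_motion_in_own_filtration_innovation)
    show "AE \<omega> in M. \<forall>t\<ge>0. \<epsilon> \<omega> * drift_process m B t \<omega> = innovation t \<omega>"
      using notN ee' AE_space
    proof eventually_elim
      fix \<omega> assume \<omega>: "\<omega> \<notin> N" "\<epsilon>' \<omega> = \<epsilon> \<omega>" "\<omega> \<in> space M"
      have "\<epsilon> \<omega> * drift_process m B t \<omega> = innovation t \<omega>" if "0 \<le> t" for t
      proof -
        have "B t \<omega> - B 0 \<omega> = B' t \<omega>" using good[of \<omega>] \<omega> that by (simp add: B'_def)
        then show ?thesis
          unfolding innovation_eq_sign_times[OF \<omega>(3) that, symmetric] drift_process_def m_def \<omega>(2) by simp
      qed
      then show "\<forall>t\<ge>0. \<epsilon> \<omega> * drift_process m B t \<omega> = innovation t \<omega>" by simp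
    qed
  qed
  ultimately show ?thesis by blast
qed

end
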